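(* Let $p\ge 5$ be a prime and let $a$ and $k$ be integers such that $1\le a\le p-1$ and $2\le k\le ap-2$. Then each of the following is true: (i) If $k\equiv \epsilon_k\pmod{p-1}$, then $v_p(s(ap,ap-k))=(v_p(k)+1)\epsilon_k$. (ii) If $2\le k\le a(p-1)-1$ and $k\not\equiv \epsilon_k\pmod{p-1}$, then $v_p(s(ap,ap-k))\ge (v_p(k)+1)\epsilon_k+1$, where equality holds if and only if $v_p\big(B_{2\lfloor \langle k\rangle/2\rfloor}\big)=0$. In particular, if $p$ is regular, then $v_p(s(ap,ap-k))=(v_p(k)+1)\epsilon_k+1$. (iii) If $a\ge 4$ and $a(p-1)+2\le k\le ap-2$, then $v_p(s(ap,ap-k))\ge a+k-ap$.
   Context: For nonnegative integers $n,k$, the (unsigned) Stirling numbers of the first kind $s(n,k)$ are defined by $x(x+1)\cdots(x+n-1)=\sum_{k=0}^n s(n,k)x^k$. For a prime $p$ and a nonzero rational $x=n_1/n_2$, $v_p(x)=v_p(n_1)-v_p(n_2)$ is the $p$-adic valuation. For an integer $k$, $\epsilon_k=0$ if $k$ is even and $\epsilon_k=1$ if $k$ is odd; $\langle k\rangle$ denotes the integer with $0\le\langle k\rangle\le p-2$ and $k\equiv\langle k\rangle\pmod{p-1}$. The Bernoulli numbers $B_n$ are defined by $\frac{x}{e^x-1}=\sum_{n\ge0}B_n\frac{x^n}{n!}$. A prime $p$ is regular if $v_p(B_l)=0$ for all even $l$ with $2\le l\le p-3$. *)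

theory Defs
  imports
    "HOL-Computational_Algebra.Computational_Algebra"
    "HOL-Combinatorics.Stirling"
    "HOL-Number_Theory.Cong"
begin

text \<open>
  The unsigned Stirling numbers of the first kind are the library's \<^const>\<open>stirling\<close>; their
  characterisation by the rising factorial is the library fact \<open>stirling_pochhammer\<close>.
\<close>

text \<open>
  As \<^const>\<open>quotient_of\<close> returns the representation in lowest terms, this is the usual
  valuation for \<open>x \<noteq> 0\<close> (\<open>p\<close> prime). At \<open>x = 0\<close> it has the junk value \<open>0\<close>.
\<close>

definition padic_val :: "nat \<Rightarrow> rat \<Rightarrow> int" where
  "padic_val p x =
     (case quotient_of x of (n, d) \<Rightarrow>
        int (multiplicity (int p) n) - int (multiplicity (int p) d))"

lemma padic_val_divide:
  fixes m n :: int
  assumes "prime p" "m \<noteq> 0" "n \<noteq> 0"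
  shows "padic_val p (of_int m / of_int n) =
           int (multiplicity (int p) m) - int (multiplicity (int p) n)"
proof -
  obtain u d where ud: "quotient_of (of_int m / of_int n) = (u, d)"
    by fastforce
  have d: "d > 0" and eq: "(of_int m / of_int n :: rat) = of_int u / of_int d"
    using quotient_of_denom_pos[OF ud] quotient_of_div[OF ud] by auto
  have "(of_int (m * d) :: rat) = of_int (u * n)"
    using eq d assms by (simp add: field_simps)
  hence mdun: "m * d = u * n" by (simp only: of_int_eq_iff)
  have u: "u \<noteq> 0" using mdun assms d by auto
  have p: "prime_elem (int p)" using assms(1) by simp
  have "multiplicity (int p) (m * d) = multiplicity (int p) (u * n)"
    by (simp add: mdun)
  hence "multiplicity (int p) m + multiplicity (int p) d =
         multiplicity (int p) u + multiplicity (int p) n"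
    using p u d assms by (simp add: prime_elem_multiplicity_mult_distrib)
  thus ?thesis by (simp add: padic_val_def ud)
qed

definition bernoulli :: "nat \<Rightarrow> rat" where
  "bernoulli n = fact n * fps_nth (fps_X / (fps_exp 1 - 1)) n"

lemma bernoulli_egf:
  "Abs_fps (\<lambda>n. bernoulli n / fact n) * (fps_exp 1 - 1) = fps_X"
proof -
  have "Abs_fps (\<lambda>n. bernoulli n / fact n) = fps_X / (fps_exp 1 - 1)"
    by (rule fps_ext) (simp add: bernoulli_def)
  moreover have "(fps_exp 1 - 1 :: rat fps) dvd fps_X"
  proof -
    have nz: "fps_nth (fps_exp 1 - 1 :: rat fps) 1 \<noteq> 0" by simp
    hence nz': "(fps_exp 1 - 1 :: rat fps) \<noteq> 0" by (metis fps_zero_nth)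
    have "subdegree (fps_exp 1 - 1 :: rat fps) \<le> 1" using nz by (rule subdegree_leI)
    thus ?thesis using nz' by (simp add: fps_dvd_iff)
  qed
  ultimately show ?thesis by simp
qed

definition regular_prime :: "nat \<Rightarrow> bool" where
  "regular_prime p \<longleftrightarrow>
     prime p \<and> (\<forall>l. even l \<and> 2 \<le> l \<and> l \<le> p - 3 \<longrightarrow> padic_val p (bernoulli l) = 0)"

definition parity_eps :: "nat \<Rightarrow> nat" where
  "parity_eps k = (if even k then 0 else 1)"

definition residue_pred :: "nat \<Rightarrow> nat \<Rightarrow> nat" where
  "residue_pred p k = k mod (p - 1)"

end

theory Submission
  imports Defs
begin

text \<open>
  Write \<open>n = a p\<close> and \<open>e\<^sub>k = s(n, n - k)\<close>. For odd \<open>k\<close> the symmetry \<open>x \<mapsto> - x - n\<close> of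
  \<open>(x + 1) \<cdots> (x + n - 1)\<close> gives \<open>2 e\<^sub>k = n (n - k) e\<^bsub>k - 1\<^esub> - \<cdots>\<close>, where the omitted terms have
  valuation at least \<open>v\<^sub>p(k) + 3\<close>; this reduces (i) and (ii) to even \<open>k\<close>. For even \<open>k\<close>, write
  \<open>x (x + 1) \<cdots> (x + p - 1) = u + p h\<close> with \<open>u = x\<^sup>p - x\<close>. Shifting \<open>x\<close> by \<open>b p\<close> changes this by
  \<open>- b p\<close> modulo \<open>p\<^sup>2\<close>, so the rising factorial of length \<open>a p\<close> is
  \<open>u\<^sup>a + p (a h + c) u\<^bsup>a - 1\<^esup>\<close> modulo \<open>p\<^sup>2\<close> with a constant \<open>c\<close> that affects only odd \<open>k\<close>. Comparing
  coefficients, \<open>e\<^sub>k\<close> is a unit if \<open>p - 1\<close> divides \<open>k\<close>, and otherwise, for \<open>k < a (p - 1)\<close>, a unit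
  times \<open>s(p, p - m)\<close> modulo \<open>p\<^sup>2\<close> with \<open>m = \<langle>k\<rangle>\<close>. For those \<open>m\<close>, the number
  \<open>(-1)\<^sup>m m s(p, p - m) / p\<close> satisfies modulo \<open>p\<close> the recurrence of the numbers \<open>- B\<^sub>m\<close>. As
  \<open>padic_val\<close> has the junk value \<open>0\<close> at \<open>0\<close>, the nonvanishing of the even Bernoulli numbers is
  needed as well. For (iii), each of the \<open>a\<close> blocks of \<open>p\<close> factors has constant term divisible by \<open>p\<close>.
\<close>

section \<open>Polynomial identities for Stirling numbers\<close>

text \<open>For \<open>j > m\<close> both sides vanish, so the library rule extends to all
  \<open>j\<close>, and sums over \<open>m\<close> need no case split.\<close>

lemma coeff_linear_poly_power':
  fixes b c :: "'a::comm_semiring_1"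
  shows "coeff ([:c, b:] ^ m) j = of_nat (m choose j) * b ^ j * c ^ (m - j)"
proof (cases "j \<le> m")
  case True
  then show ?thesis by (rule coeff_linear_poly_power)
next
  case False
  have "degree ([:c, b:] ^ m) \<le> degree [:c, b:] * m" by (rule degree_power_le)
  also have "\<dots> \<le> m" by simp
  finally show ?thesis using False by (simp add: coeff_eq_0 binomial_eq_0)
qed

lemma coeff_pochhammer_linear:
  fixes b c :: "'a::comm_semiring_1"
  shows "coeff (pochhammer [:c, b:] n) j =
    (\<Sum>m\<le>n. of_nat (stirling n m) * (of_nat (m choose j) * b ^ j * c ^ (m - j)))"
proof -
  have "pochhammer [:c, b:] n = (\<Sum>m\<le>n. smult (of_nat (stirling n m)) ([:c, b:] ^ m))"
    by (simp add: stirling_pochhammer [symmetric] of_nat_poly)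
  then show ?thesis by (simp only: coeff_sum coeff_smult coeff_linear_poly_power')
qed

lemma coeff_pochhammer_X:
  "coeff (pochhammer [:0, 1:] n) j = (of_nat (stirling n j) :: 'a::comm_semiring_1)"
proof -
  have "coeff (pochhammer [:0, 1:] n) j =
      (\<Sum>m\<le>n. if m = j then of_nat (stirling n m) else (0::'a))"
    unfolding coeff_pochhammer_linear
    by (intro sum.cong refl) (auto simp: binomial_eq_0 power_0_left not_less dest: le_neq_implies_less)
  then show ?thesis by simp
qed

text \<open>Lagrange's recurrence: with \<open>P\<close> the rising factorial of length
  \<open>n\<close>, compare the coefficients of degree \<open>n - k\<close> in
  \<open>x * P(x + 1) = P(x) * (x + n)\<close>. The terms \<open>stirling n j\<close> with
  \<open>j = n - k - 1\<close> cancel, and those in \<open>stirling n (Suc j)\<close> combine to the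
  factor \<open>n - Suc j = k\<close>.\<close>

lemma stirling_Lagrange:
  assumes "k < n"
  shows "k * stirling n (n - k) =
    (\<Sum>i<k. ((n - i) choose (k + 1 - i)) * stirling n (n - i))"
proof -
  define j where "j = n - k - 1"
  have n: "n = Suc j + k" using assms by (simp add: j_def)
  let ?X = "[:0, 1:] :: nat poly"
  have "?X * pochhammer [:1, 1:] n = pochhammer ?X n * (?X + of_nat n)"
    using pochhammer_rec [of ?X n] pochhammer_Suc [of ?X n] by (simp add: one_pCons)
  then have "coeff (?X * pochhammer [:1, 1:] n) (Suc j) =
      coeff (pochhammer ?X n * (?X + of_nat n)) (Suc j)" by simp
  moreover have "pochhammer ?X n * (?X + of_nat n) =
      pCons 0 (pochhammer ?X n) + smult n (pochhammer ?X n)"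
    by (simp add: of_nat_poly algebra_simps del: One_nat_def)
  ultimately have "(\<Sum>m\<le>n. stirling n m * (m choose j)) = stirling n j + n * stirling n (Suc j)"
    by (simp add: coeff_pochhammer_linear [of 1 1] coeff_pochhammer_X del: One_nat_def)
  also have "(\<Sum>m\<le>n. stirling n m * (m choose j)) = (\<Sum>m\<in>{j..n}. stirling n m * (m choose j))"
    by (intro sum.mono_neutral_right) (auto simp: binomial_eq_0)
  also have "{j..n} = insert j (insert (Suc j) {Suc (Suc j)..n})"
    using n by auto
  also have "(\<Sum>m\<in>\<dots>. stirling n m * (m choose j)) =
      stirling n j + Suc j * stirling n (Suc j) +
      (\<Sum>m\<in>{Suc (Suc j)..n}. stirling n m * (m choose j))"
    by simp
  also have "(\<Sum>m\<in>{Suc (Suc j)..n}. stirling n m * (m choose j)) =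
      (\<Sum>i<k. ((n - i) choose (k + 1 - i)) * stirling n (n - i))"
  proof (rule sum.reindex_bij_witness [of _ "\<lambda>i. n - i" "\<lambda>m. n - m"])
    fix m assume m: "m \<in> {Suc (Suc j)..n}"
    then have "m choose j = m choose (k + 1 - (n - m))"
      using n by (subst binomial_symmetric) (auto intro: arg_cong [where f = "binomial m"])
    then show "((n - (n - m)) choose (k + 1 - (n - m))) * stirling n (n - (n - m)) =
        stirling n m * (m choose j)" using m by simp
  qed (use n in auto)
  finally have "Suc j * stirling n (Suc j) +
      (\<Sum>i<k. ((n - i) choose (k + 1 - i)) * stirling n (n - i)) = n * stirling n (Suc j)"
    by linarith
  moreover have "n * stirling n (Suc j) = Suc j * stirling n (Suc j) + k * stirling n (Suc j)"
    by (subst n) (simp only: add_mult_distrib)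
  moreover have "n - k = Suc j" using n by simp
  ultimately show ?thesis by (simp del: stirling.simps)
qed

text \<open>Cancelling \<open>x\<close> from the expansion of \<open>x (x + 1) ... (x + n)\<close>
  shifts both Stirling indices by one.\<close>

lemma pochhammer_plus_one_stirling:
  fixes x :: "'a::idom"
  assumes "x \<noteq> 0"
  shows "pochhammer (x + 1) n = (\<Sum>m\<le>n. of_nat (stirling (Suc n) (Suc m)) * x ^ m)"
proof -
  have "x * pochhammer (x + 1) n = pochhammer x (Suc n)" by (simp add: pochhammer_rec)
  also have "\<dots> = x * (\<Sum>m\<le>n. of_nat (stirling (Suc n) (Suc m)) * x ^ m)"
    by (simp add: stirling_pochhammer [symmetric] sum.atMost_Suc_shift sum_distrib_left mult_ac
        del: sum.atMost_Suc stirling.simps)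
  finally show ?thesis using assms by simp
qed

text \<open>The substitution of \<open>- x - (n + 1)\<close> for \<open>x\<close> permutes the
  factors of \<open>(x + 1) ... (x + n)\<close> up to the sign \<open>(-1)^n\<close>; compare the
  coefficients of \<open>x^j\<close>.\<close>

lemma stirling_reflection:
  "(-1) ^ n * int (stirling (Suc n) (Suc j)) =
    (\<Sum>m\<le>n. (-1) ^ m * int (stirling (Suc n) (Suc m)) * int (m choose j) * int (Suc n) ^ (m - j))"
proof -
  let ?X = "[:0, 1:] :: int poly" and ?Y = "[:- int (Suc n), - 1:]"
  have "- (?X + of_nat n) = ?Y + 1"
    by (simp add: of_nat_poly one_pCons)
  then have "pochhammer (?Y + 1) n = (- 1) ^ n * pochhammer (?X + 1) n"
    using pochhammer_minus [of "?X + of_nat n" n] by (simp add: algebra_simps)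
  moreover have *: "pochhammer ([:c, b:] + 1) n =
      (\<Sum>m\<le>n. smult (of_nat (stirling (Suc n) (Suc m))) ([:c, b:] ^ m))"
    if "b \<noteq> 0" for b c :: int
    using that by (subst pochhammer_plus_one_stirling) (auto simp: of_nat_poly)
  ultimately have "(\<Sum>m\<le>n. smult (of_nat (stirling (Suc n) (Suc m))) (?Y ^ m)) =
      (- 1) ^ n * (\<Sum>m\<le>n. smult (of_nat (stirling (Suc n) (Suc m))) (?X ^ m))" by simp
  also have "(- 1) ^ n = [:(- 1) ^ n :: int:]"
    by (simp add: poly_const_pow one_pCons)
  finally have "coeff (\<Sum>m\<le>n. smult (of_nat (stirling (Suc n) (Suc m))) (?Y ^ m)) j =
      coeff ([:(- 1) ^ n:] * (\<Sum>m\<le>n. smult (of_nat (stirling (Suc n) (Suc m))) (?X ^ m))) j"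
    by simp
  then have "(\<Sum>m\<le>n. int (stirling (Suc n) (Suc m)) *
        (int (m choose j) * (- 1) ^ j * (- int (Suc n)) ^ (m - j))) =
      (- 1) ^ n * (\<Sum>m\<le>n. int (stirling (Suc n) (Suc m)) * (int (m choose j) * 1 ^ j * 0 ^ (m - j)))"
    by (simp only: coeff_sum coeff_smult coeff_linear_poly_power' mult_pCons_left
        mult_zero_left pCons_0_0 add_0_right)
  also have "(\<Sum>m\<le>n. int (stirling (Suc n) (Suc m)) * (int (m choose j) * 1 ^ j * 0 ^ (m - j))) =
      (\<Sum>m\<le>n. if m = j then int (stirling (Suc n) (Suc m)) else 0)"
    by (intro sum.cong refl)
      (auto simp: binomial_eq_0 power_0_left not_less dest: le_neq_implies_less)
  also have "\<dots> = int (stirling (Suc n) (Suc j))"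
    by simp
  also have "(\<Sum>m\<le>n. int (stirling (Suc n) (Suc m)) *
        (int (m choose j) * (- 1) ^ j * (- int (Suc n)) ^ (m - j))) =
      (\<Sum>m\<le>n. (-1) ^ m * int (stirling (Suc n) (Suc m)) * int (m choose j) * int (Suc n) ^ (m - j))"
  proof (intro sum.cong refl)
    fix m
    show "int (stirling (Suc n) (Suc m)) *
        (int (m choose j) * (- 1) ^ j * (- int (Suc n)) ^ (m - j)) =
      (-1) ^ m * int (stirling (Suc n) (Suc m)) * int (m choose j) * int (Suc n) ^ (m - j)"
    proof (cases "j \<le> m")
      case True
      then have "(-1::int) ^ m = (-1) ^ j * (-1) ^ (m - j)"
        by (simp flip: power_add)
      then show ?thesis by (subst power_minus) (simp add: mult_ac)
    qed (simp add: binomial_eq_0)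
  qed
  finally show ?thesis by simp
qed

section \<open>Stirling numbers with odd index difference\<close>

text \<open>In the reflection identity of row \<open>n\<close>, the leading term on the right is
  \<open>S t\<close> with the sign opposite to that on the left, so moving it over doubles
  \<open>S t\<close>. The next three terms are kept explicitly; everything after them carries
  \<open>n^4\<close>.\<close>

lemma stirling_odd_expansion:
  fixes n t :: nat
  defines "S \<equiv> \<lambda>i. int (stirling n i)"
  assumes t: "1 \<le> t" "t \<le> n" and odd: "odd (n - t)"
  obtains w where "2 * S t = int n * int t * S (t + 1) - int n ^ 2 * int ((t + 1) choose 2) * S (t + 2)
     + int n ^ 3 * int ((t + 2) choose 3) * S (t + 3) + int n ^ 4 * w"
proof -
  obtain N j where n: "n = Suc N" and t': "t = Suc j"
    using t by (metis Suc_le_D One_nat_def le_trans)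
  define T where "T = (\<lambda>m. (-1) ^ m * S (Suc m) * int (m choose j) * int n ^ (m - j))"
  have "(-1) ^ N * S (Suc j) = (\<Sum>m\<le>N. T m)"
    unfolding T_def S_def n by (rule stirling_reflection)
  \<comment> \<open>The enlarged range adds only zero terms, so that four terms can be split off
    however small \<open>N\<close> is.\<close>
  also have "\<dots> = (\<Sum>m\<in>{j..j+(N+4)}. T m)"
    by (rule sum.mono_neutral_cong)
      (auto simp: T_def S_def n binomial_eq_0 not_le simp del: stirling.simps)
  also have "\<dots> = (\<Sum>r\<le>N+4. T (j + r))"
    by (rule sum.reindex_bij_witness [of _ "\<lambda>r. j + r" "\<lambda>m. m - j"]) auto
  also have "N + 4 = Suc (Suc (Suc (Suc N)))" by simp
  also have "(\<Sum>r\<le>\<dots>. T (j + r)) =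
      T j + T (j+1) + T (j+2) + T (j+3) + (\<Sum>r\<le>N. T (j + r + 4))"
    by (simp only: sum.atMost_Suc_shift) (simp add: eval_nat_numeral)
  finally have A: "(-1) ^ N * S (Suc j) =
      T j + T (j+1) + T (j+2) + T (j+3) + (\<Sum>r\<le>N. T (j + r + 4))" .
  define w where "w = (\<Sum>r\<le>N. (-1) ^ r * S (Suc (j + r + 4)) * int ((j + r + 4) choose j) * int n ^ r)"
  have B: "(\<Sum>r\<le>N. T (j + r + 4)) = (-1) ^ j * int n ^ 4 * w"
    unfolding w_def sum_distrib_left
    by (intro sum.cong refl) (simp add: T_def power_add mult_ac)
  have ch: "(j + 2) choose j = (t + 1) choose 2" "(j + 3) choose j = (t + 2) choose 3"
    using binomial_symmetric [of j "j+2"] binomial_symmetric [of j "j+3"]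
    by (simp_all add: t' eval_nat_numeral del: binomial_Suc_Suc)
  have T: "T j = (-1) ^ j * S t" "T (j+1) = - ((-1) ^ j * (int n * int t * S (t + 1)))"
    "T (j+2) = (-1) ^ j * (int n ^ 2 * int ((t + 1) choose 2) * S (t + 2))"
    "T (j+3) = - ((-1) ^ j * (int n ^ 3 * int ((t + 2) choose 3) * S (t + 3)))"
    unfolding T_def ch
    by (simp_all add: t' power_add mult_ac add.commute eval_nat_numeral del: binomial_Suc_Suc)
  \<comment> \<open>Here the oddness of \<open>n - t = N - j\<close> enters.\<close>
  have "(-1::int) ^ N = - ((-1) ^ j)"
    using odd t by (cases "even j") (auto simp: n t')
  with A B T have "(-1) ^ j * (2 * S t) = (-1) ^ j * (int n * int t * S (t + 1) -
      int n ^ 2 * int ((t + 1) choose 2) * S (t + 2)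
     + int n ^ 3 * int ((t + 2) choose 3) * S (t + 3) + int n ^ 4 * (- w))"
    by (simp add: t' algebra_simps)
  then have "2 * S t = int n * int t * S (t + 1) - int n ^ 2 * int ((t + 1) choose 2) * S (t + 2)
     + int n ^ 3 * int ((t + 2) choose 3) * S (t + 3) + int n ^ 4 * (- w)"
    by (simp only: mult_cancel_left power_eq_0_iff) simp
  then show ?thesis by (rule that)
qed

text \<open>Every term of the expansion of \<open>2 * S t\<close> contains a factor
  \<open>n\<close>, and \<open>2\<close> is invertible modulo \<open>p\<close>.\<close>

lemma prime_dvd_stirling_odd:
  assumes "prime p" "p \<noteq> 2" "p dvd n" "1 \<le> t" "odd (n - t)"
  shows "p dvd stirling n t"
proof -
  have "t \<le> n" using assms(5) by (cases "t \<le> n") auto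
  with assms obtain w where w: "2 * int (stirling n t) = int n * int t * int (stirling n (t + 1)) -
       int n ^ 2 * int ((t + 1) choose 2) * int (stirling n (t + 2))
     + int n ^ 3 * int ((t + 2) choose 3) * int (stirling n (t + 3)) + int n ^ 4 * w"
    using stirling_odd_expansion [of t n] by metis
  have "int p dvd 2 * int (stirling n t)"
    unfolding w using assms(3) by (intro dvd_add dvd_diff) (auto intro!: dvd_mult2 dvd_power simp: power2_eq_square power3_eq_cube power4_eq_xxxx)
  then have "p dvd 2 * stirling n t"
    by (metis int_dvd_int_iff of_nat_mult of_nat_numeral)
  then show ?thesis using assms(1,2)
    by (metis prime_dvd_mult_iff primes_dvd_imp_eq two_is_prime_nat)
qed

text \<open>With \<open>n = a * p\<close>, \<open>t = n - k\<close> and \<open>v\<close> the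
  multiplicity of \<open>p\<close> in \<open>k\<close>, the leading term
  \<open>n * t * S (t + 1)\<close> is \<open>p^(v + 1)\<close> times a unit times
  \<open>S (t + 1)\<close>, while the later terms are divisible by \<open>p^(v + 3)\<close>. Hence
  the bound \<open>e \<le> 2\<close>, which suffices to tell the valuations 0, 1 and at least 2 of
  \<open>S (t + 1)\<close> apart.\<close>

lemma power_dvd_stirling_odd_iff:
  fixes p a k :: nat
  assumes p: "prime p" "p \<ge> 5" and a: "1 \<le> a" "a < p"
    and k: "odd k" "3 \<le> k" "k < a * p" and e: "e \<le> 2"
  shows "p ^ (multiplicity p k + 1 + e) dvd stirling (a * p) (a * p - k) \<longleftrightarrow>
    p ^ e dvd stirling (a * p) (a * p - (k - 1))"
proof -
  define n t v where "n = a * p" and "t = n - k" and "v = multiplicity p k"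
  define S where "S = (\<lambda>i. int (stirling n i))"
  have nt: "n - t = k" "1 \<le> t" "t \<le> n" using k by (auto simp: t_def n_def)
  obtain w where w: "2 * S t = int n * int t * S (t + 1) -
       int n ^ 2 * int ((t + 1) choose 2) * S (t + 2)
     + int n ^ 3 * int ((t + 2) choose 3) * S (t + 3) + int n ^ 4 * w"
    using stirling_odd_expansion [of t n] nt k(1) unfolding S_def by metis
  have pn: "p dvd n" by (simp add: n_def)
  have pk: "p dvd k \<longleftrightarrow> p dvd t"
    using nt pn by (metis dvd_diff_nat diff_diff_cancel t_def)
  have "a * p < p * p" using a p by simp
  \<comment> \<open>As \<open>n < p^2\<close>, the multiplicities of \<open>p\<close> in
    \<open>k\<close> and \<open>t\<close> are at most 1. They agree because \<open>k + t = n\<close>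
    is divisible by \<open>p\<close>, and \<open>v < 2\<close> later puts the \<open>n^4\<close>
    term below the error bound.\<close>
  have not2: "\<not> p ^ 2 dvd m" if "0 < m" "m < n" for m
  proof
    assume "p ^ 2 dvd m"
    with that have "p * p \<le> m" by (auto simp: power2_eq_square dest: dvd_imp_le)
    with that \<open>a * p < p * p\<close> show False by (simp add: n_def)
  qed
  have k0: "0 < k" "k < n" and t0: "0 < t" "t < n" using k nt by (auto simp: n_def)
  have mult: "multiplicity p m = (if p dvd m then 1 else 0)" if "0 < m" "m < n" for m
    using not2 [OF that] by (auto intro!: multiplicity_eqI simp: numeral_2_eq_2)
  have vt: "multiplicity p t = v" and "v < 2"
    unfolding v_def mult [OF k0] mult [OF t0] using pk by auto
  obtain u where u: "t = p ^ v * u" and pu: "\<not> p dvd u"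
    using multiplicity_decompose' [of t p] t0 p vt by (metis not_prime_unit less_numeral_extra(3))
  have pt: "int p ^ v dvd int t" by (simp add: u)
  have coprime_p: "coprime (int p ^ i) (int q)" if "\<not> p dvd q" for i q
    using prime_imp_coprime [OF p(1) that] by (metis coprime_int_iff coprime_power_left_iff)
  \<comment> \<open>The denominators 2 and 3 of the two binomial coefficients are units modulo
    \<open>p\<close>, so both coefficients inherit the factor \<open>p^v\<close> of
    \<open>t\<close>.\<close>
  have "\<not> p dvd 2" "\<not> p dvd 3" using p by (auto dest!: dvd_imp_le)
  note cop = this [THEN coprime_p]
  have c2: "int ((t + 1) choose 2) * int 2 = (int t + 1) * int t"
    using Suc_times_binomial_eq [of t 1] unfolding of_nat_mult [symmetric]
    by (metis (no_types, lifting) Suc_1 Suc_eq_plus1 binomial_n_n choose_one of_nat_Suc of_nat_mult add.commute)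
  have c3: "int ((t + 2) choose 3) * int 3 = (int t + 2) * int ((t + 1) choose 2)"
  proof -
    have "Suc (t + 1) = t + 2" "Suc 2 = 3" by simp_all
    with Suc_times_binomial_eq [of "t + 1" 2]
    have "((t + 2) choose 3) * 3 = (t + 2) * ((t + 1) choose 2)" by metis
    from arg_cong [OF this, of int] show ?thesis by (simp only: of_nat_mult of_nat_add of_nat_numeral)
  qed
  have d2: "int p ^ v dvd int ((t + 1) choose 2)"
    using c2 pt cop(1) by (metis coprime_dvd_mult_left_iff dvd_mult)
  have d3: "int p ^ v dvd int ((t + 2) choose 3)"
    using c3 d2 cop(2) by (metis coprime_dvd_mult_left_iff dvd_mult)
  \<comment> \<open>The index difference is again odd, so \<open>S (t + 2)\<close> supplies the
    third factor \<open>p\<close> beyond the two from \<open>n^2\<close>.\<close>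
  have "n - (t + 2) = k - 2" using nt by linarith
  then have "odd (n - (t + 2))" using k by (simp only: even_diff_nat) auto
  then have pS: "int p dvd S (t + 2)" using prime_dvd_stirling_odd [of p n "t + 2"] p pn
    by (simp add: S_def)
  have pn': "int p dvd int n" using pn by simp
  have 1: "int p ^ (v + 3) dvd int n ^ 2 * int ((t + 1) choose 2) * S (t + 2)"
  proof -
    have "int p ^ (v + 3) = int p ^ 2 * int p ^ v * int p" by (simp add: power_add eval_nat_numeral)
    then show ?thesis using pn' d2 pS by (simp only:) (intro mult_dvd_mono dvd_power_same)
  qed
  have 2: "int p ^ (v + 3) dvd int n ^ 3 * int ((t + 2) choose 3) * S (t + 3)"
  proof -
    have "int p ^ (v + 3) = int p ^ 3 * int p ^ v * 1" by (simp add: power_add)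
    then show ?thesis using pn' d3 by (simp only:) (intro mult_dvd_mono dvd_power_same one_dvd)
  qed
  have 3: "int p ^ (v + 3) dvd int n ^ 4 * w"
  proof -
    have "int p ^ (v + 3) dvd int p ^ 4" using \<open>v < 2\<close> by (intro le_imp_power_dvd) simp
    also have "int p ^ 4 dvd int n ^ 4" using pn' by (rule dvd_power_same)
    finally show ?thesis by (rule dvd_mult2)
  qed
  have "2 * S t - int n * int t * S (t + 1) =
    - (int n ^ 2 * int ((t + 1) choose 2) * S (t + 2)) +
    int n ^ 3 * int ((t + 2) choose 3) * S (t + 3) + int n ^ 4 * w"
    using w by simp
  then have "int p ^ (v + 3) dvd 2 * S t - int n * int t * S (t + 1)"
    using 1 2 3 by (simp only: dvd_add dvd_minus_iff)
  moreover have "int p ^ (v + 1 + e) dvd int p ^ (v + 3)" using e by (intro le_imp_power_dvd) simp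
  ultimately have D: "int p ^ (v + 1 + e) dvd 2 * S t - int n * int t * S (t + 1)"
    by (rule dvd_trans [rotated])
  have "\<not> p dvd a" using a by (auto dest: dvd_imp_le)
  have "int n * int t = int p ^ (v + 1) * (int a * int u)" by (simp add: n_def u)
  then have E: "int n * int t * S (t + 1) = int p ^ (v + 1) * ((int a * int u) * S (t + 1))" by simp
  have "int p ^ (v + 1 + e) dvd S t \<longleftrightarrow> int p ^ (v + 1 + e) dvd 2 * S t"
    using coprime_dvd_mult_right_iff [OF cop(1) [of "v + 1 + e"], of "S t"]
    by (simp only: of_nat_numeral)
  also have "\<dots> \<longleftrightarrow> int p ^ (v + 1 + e) dvd int n * int t * S (t + 1)"
    using D by (metis dvd_diff_right_iff dvd_diffD dvd_diffD1 dvd_add_right_iff diff_add_cancel)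
  also have "\<dots> \<longleftrightarrow> int p ^ e dvd (int a * int u) * S (t + 1)"
    unfolding E power_add [of _ "v + 1" e] using p by simp
  also have "\<dots> \<longleftrightarrow> int p ^ e dvd S (t + 1)"
  proof -
    have "\<not> p dvd a * u" using \<open>\<not> p dvd a\<close> pu p by (simp add: prime_dvd_mult_iff)
    from coprime_p [OF this] have "coprime (int p ^ e) (int a * int u)" by simp
    then show ?thesis by (simp add: coprime_dvd_mult_right_iff)
  qed
  finally have "int (p ^ (v + 1 + e)) dvd int (stirling n t) \<longleftrightarrow> int (p ^ e) dvd int (stirling n (t + 1))"
    by (simp add: S_def)
  then have "p ^ (v + 1 + e) dvd stirling n t \<longleftrightarrow> p ^ e dvd stirling n (t + 1)"
    by (simp only: int_dvd_int_iff)
  moreover have "t + 1 = n - (k - 1)" using k by (simp add: t_def n_def)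
  ultimately show ?thesis by (simp only: n_def t_def v_def)
qed

section \<open>Bernoulli numbers\<close>

text \<open>This is the coefficient of degree \<open>k + 1\<close> in \<open>bernoulli_egf\<close>,
  multiplied by \<open>(k + 1)!\<close>.\<close>

lemma bernoulli_sum:
  "(\<Sum>i\<le>k. of_nat (Suc k choose i) * bernoulli i) = (if k = 0 then 1 else 0)"
proof -
  define F where "F = Abs_fps (\<lambda>n. bernoulli n / fact n)"
  have "fps_nth (F * (fps_exp 1 - 1)) (Suc k) = (if k = 0 then 1 else 0)"
    unfolding F_def bernoulli_egf by simp
  also have "fps_nth (F * (fps_exp 1 - 1)) (Suc k) =
      (\<Sum>i=0..k. bernoulli i / fact i * (1 / fact (Suc k - i)))"
    unfolding fps_mult_nth sum.atLeast0_atMost_Suc by (auto simp: F_def intro!: sum.cong)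
  finally have "fact (Suc k) * (\<Sum>i=0..k. bernoulli i / fact i * (1 / fact (Suc k - i))) =
      (if k = 0 then 1 else 0)" by simp
  also have "fact (Suc k) * (\<Sum>i=0..k. bernoulli i / fact i * (1 / fact (Suc k - i))) =
      (\<Sum>i\<le>k. of_nat (Suc k choose i) * bernoulli i)"
    unfolding sum_distrib_left atMost_atLeast0
    by (intro sum.cong refl) (simp add: binomial_fact del: fact_Suc binomial_Suc_Suc)
  finally show ?thesis .
qed

lemma bernoulli_0: "bernoulli 0 = 1"
  using bernoulli_sum [of 0] by simp

lemma bernoulli_recurrence:
  assumes "1 \<le> k"
  shows "of_nat (k + 1) * bernoulli k =
    - 1 - (\<Sum>i\<in>{1..<k}. of_nat ((k + 1) choose i) * bernoulli i)"
proof -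
  have "{..k} = insert 0 (insert k {1..<k})" using assms by auto
  with bernoulli_sum [of k] assms show ?thesis by (simp add: bernoulli_0 algebra_simps)
qed

text \<open>Euler's identity: differentiating \<open>F * (exp x - 1) = x\<close> and multiplying by
  \<open>F\<close> gives \<open>F^2 = F - x F - x F'\<close>.\<close>

lemma bernoulli_convolution:
  fixes n :: nat
  defines "c \<equiv> \<lambda>n. bernoulli n / fact n"
  assumes "1 \<le> n"
  shows "(\<Sum>i\<le>n. c i * c (n - i)) = (1 - of_nat n) * c n - c (n - 1)"
proof -
  define F where "F = Abs_fps c"
  have 1: "F * (fps_exp 1 - 1) = fps_X"
    unfolding F_def c_def by (rule bernoulli_egf)
  then have 2: "F * fps_exp 1 = F + fps_X" by (simp add: algebra_simps)
  have "fps_deriv (F * (fps_exp 1 - 1)) = 1" unfolding 1 by simp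
  moreover have "fps_deriv (F * (fps_exp 1 - 1)) = fps_deriv F * (fps_exp 1 - 1) + F * fps_exp 1"
    by (simp add: add.commute)
  ultimately have "fps_deriv F * (fps_exp 1 - 1) = 1 - fps_X - F"
    unfolding 2 by (simp add: algebra_simps)
  then have "F * (fps_deriv F * (fps_exp 1 - 1)) = F * (1 - fps_X - F)" by simp
  moreover have "F * (fps_deriv F * (fps_exp 1 - 1)) = fps_X * fps_deriv F"
    using 1 by (metis mult.assoc mult.commute)
  ultimately have "F * F = F - fps_X * F - fps_X * fps_deriv F" by (simp add: algebra_simps)
  then have "fps_nth (F * F) n = c n - c (n - 1) - of_nat n * c n"
    using assms(2) by (simp add: F_def)
  then show ?thesis by (simp add: F_def fps_mult_nth atMost_atLeast0 algebra_simps)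
qed

text \<open>The generating function satisfies \<open>F(-x) = F(x) + x\<close>, so beyond degree 1
  its odd coefficients vanish.\<close>

lemma bernoulli_odd_eq_0:
  assumes "odd n" "n \<noteq> 1"
  shows "bernoulli n = 0"
proof -
  define F where "F = Abs_fps (\<lambda>n. bernoulli n / fact n)"
  define G where "G = F oo (- fps_X)"
  let ?E = "fps_exp 1 :: rat fps"
  have 1: "F * (?E - 1) = fps_X" unfolding F_def by (rule bernoulli_egf)
  then have "(F * (?E - 1)) oo (- fps_X) = fps_X oo (- fps_X)" by simp
  then have "G * (fps_exp (-1) - 1) = - fps_X"
    by (simp add: G_def fps_compose_mult_distrib fps_compose_sub_distrib)
  then have "G * (fps_exp (-1) - 1) * ?E = - fps_X * ?E" by simp
  moreover have "fps_exp (-1) * ?E = 1"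
    using fps_exp_add_mult [of "-1" "1::rat"] by simp
  ultimately have "G * (?E - 1) = fps_X * ?E"
    by (simp add: algebra_simps)
  also have "\<dots> = (F + fps_X) * (?E - 1)" using 1 by (simp add: algebra_simps)
  finally have "G * (?E - 1) = (F + fps_X) * (?E - 1)" .
  moreover have "?E - 1 \<noteq> 0" using 1 by auto
  ultimately have "G = F + fps_X" by simp
  then have "fps_nth G n = fps_nth (F + fps_X) n" by simp
  then show ?thesis using assms by (simp add: G_def F_def fps_compose_uminus')
qed

text \<open>In Euler's identity only products of earlier even-indexed terms remain, and by induction
  they all have the same sign. Proving the sign rather than mere nonvanishing excludes
  cancellation.\<close>

lemma bernoulli_even_sign:
  assumes "1 \<le> m"
  shows "(- 1) ^ (m + 1) * bernoulli (2 * m) > 0"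
proof -
  define c where "c = (\<lambda>n. bernoulli n / fact n)"
  have conv: "(\<Sum>i\<le>n. c i * c (n - i)) = (1 - of_nat n) * c n - c (n - 1)" if "1 \<le> n" for n
    using that unfolding c_def by (rule bernoulli_convolution)
  have c0: "c 0 = 1" by (simp add: c_def bernoulli_0)
  have c1: "c 1 = - 1 / 2" using conv [of 1] c0 by simp
  have "(- 1) ^ (m + 1) * c (2 * m) > 0"
    using assms
  proof (induction m rule: less_induct)
    case (less m)
    show ?case
    proof (cases "m = 1")
      case True
      \<comment> \<open>The case \<open>m = 1\<close> is separate because \<open>c 1\<close> is
        nonzero and enters the convolution.\<close>
      have "3 * c 2 = 1 / 4" using conv [of 2] c0 c1 by (simp add: eval_nat_numeral)
      then show ?thesis by (simp add: True)
    next
      case False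
      with less.prems have m: "2 \<le> m" by simp
      have odd0: "c i = 0" if "odd i" "i \<noteq> 1" for i using that by (simp add: c_def bernoulli_odd_eq_0)
      have "{..2 * m} = insert 0 (insert (2 * m) {1..<2 * m})" using m by auto
      moreover have "c (2 * m - 1) = 0" using m by (intro odd0) auto
      ultimately have "of_nat (2 * m + 1) * c (2 * m) = - (\<Sum>i\<in>{1..<2 * m}. c i * c (2 * m - i))"
        using conv [of "2 * m"] m c0 by (simp add: algebra_simps)
      then have "of_nat (2 * m + 1) * ((- 1) ^ (m + 1) * c (2 * m)) =
          (\<Sum>i\<in>{1..<2 * m}. (- 1) ^ m * (c i * c (2 * m - i)))"
        by (simp add: sum_distrib_left algebra_simps)
      also have "\<dots> > 0"
      proof (rule sum_pos2)
        have pos: "(- 1) ^ m * (c (2 * l) * c (2 * m - 2 * l)) > 0" if "1 \<le> l" "l < m" for l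
        proof -
          have "0 < ((- 1) ^ (l + 1) * c (2 * l)) * ((- 1) ^ (m - l + 1) * c (2 * (m - l)))"
            using that by (intro mult_pos_pos less.IH) auto
          also have "\<dots> = ((- 1) ^ (l + 1) * (- 1) ^ (m - l + 1)) * (c (2 * l) * c (2 * m - 2 * l))"
            by (simp add: diff_mult_distrib2)
          also have "(- 1 :: rat) ^ (l + 1) * (- 1) ^ (m - l + 1) = (- 1) ^ m"
            using that by (simp flip: power_add)
          finally show ?thesis .
        qed
        from pos [of 1] m show "(- 1) ^ m * (c 2 * c (2 * m - 2)) > 0" by simp
        show "2 \<in> {1..<2 * m}" using m by simp
        fix i assume i: "i \<in> {1..<2 * m}"
        show "(- 1) ^ m * (c i * c (2 * m - i)) \<ge> 0"
        proof (cases "even i")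
          case True
          with i pos [of "i div 2"] show ?thesis by auto
        next
          case False
          \<comment> \<open>For \<open>i = 1\<close> the second factor vanishes, since
            \<open>2 * m - 1\<close> is odd and larger than 1.\<close>
          then have "c i * c (2 * m - i) = 0"
            using odd0 [of i] odd0 [of "2 * m - i"] i m by (cases "i = 1") auto
          then show ?thesis by (simp only: mult_zero_right order_refl)
        qed
      qed simp
      finally show ?thesis by (simp only: zero_less_mult_iff of_nat_0_less_iff) auto
    qed
  qed
  then show ?thesis by (simp add: c_def divide_less_0_iff)
qed

corollary bernoulli_even_nonzero: "even n \<Longrightarrow> 2 \<le> n \<Longrightarrow> bernoulli n \<noteq> 0"
  using bernoulli_even_sign [of "n div 2"] by auto

section \<open>Stirling numbers of prime row and Bernoulli numbers modulo a prime\<close>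

lemma padic_val_of_nat:
  assumes "prime p" "0 < m"
  shows "padic_val p (of_nat m) = int (multiplicity p m)"
proof -
  have "multiplicity (int p) (int m) = multiplicity p m"
  proof (rule multiplicity_eqI)
    have dvd: "int p ^ k dvd int m \<longleftrightarrow> p ^ k dvd m" for k
      by (metis int_dvd_int_iff of_nat_power)
    show "int p ^ multiplicity p m dvd int m"
      unfolding dvd by (rule multiplicity_dvd)
    show "\<not> int p ^ Suc (multiplicity p m) dvd int m"
      unfolding dvd using assms
      by (subst power_dvd_iff_le_multiplicity) (auto dest: not_prime_unit)
  qed
  then show ?thesis
    using padic_val_divide [of p "int m" 1] assms by simp
qed

text \<open>Modulo \<open>p\<close> the upper entry \<open>p - i\<close> acts like
  \<open>- i\<close>, and the right-hand side is the generalised binomial coefficient of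
  \<open>- i\<close> over \<open>m\<close>. The induction divides by \<open>Suc m\<close>, a unit
  because \<open>m < p\<close>.\<close>

lemma cong_binomial_prime_diff:
  assumes "prime p" "1 \<le> i" "i \<le> p" "m < p"
  shows "[int ((p - i) choose m) = (- 1) ^ m * int ((i + m - 1) choose m)] (mod int p)"
  using assms(4)
proof (induction m)
  case (Suc m)
  have "(p - i - m) * ((p - i) choose m) = Suc m * ((p - i) choose Suc m)"
    by (simp only: binomial_absorption binomial_absorb_comp)
  \<comment> \<open>Where the natural subtraction truncates, the binomial coefficient is
    zero.\<close>
  moreover have "int (p - i - m) * int ((p - i) choose m) = (int p - int i - int m) * int ((p - i) choose m)"
    using assms(3) by (cases "m \<le> p - i") (auto simp: of_nat_diff binomial_eq_0)
  ultimately have "int (Suc m) * int ((p - i) choose Suc m) = (int p - int i - int m) * int ((p - i) choose m)"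
    by (metis of_nat_mult)
  also have "[\<dots> = (0 - int i - int m) * ((- 1) ^ m * int ((i + m - 1) choose m))] (mod int p)"
    using Suc by (intro cong_mult cong_diff cong_refl) (auto simp: cong_def)
  also have "(0 - int i - int m) * ((- 1) ^ m * int ((i + m - 1) choose m)) =
      (- 1) ^ Suc m * int (Suc (i + m - 1) * ((i + m - 1) choose m))"
    using assms(2) by (simp add: of_nat_diff algebra_simps)
  also have "\<dots> = int (Suc m) * ((- 1) ^ Suc m * int ((i + Suc m - 1) choose Suc m))"
    unfolding Suc_times_binomial_eq using assms(2) by (simp add: algebra_simps del: binomial_Suc_Suc)
  finally have "[int (Suc m) * int ((p - i) choose Suc m) =
      int (Suc m) * ((- 1) ^ Suc m * int ((i + Suc m - 1) choose Suc m))] (mod int p)" .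
  moreover have "coprime (int (Suc m)) (int p)"
  proof -
    have "\<not> p dvd Suc m" using Suc.prems by (auto dest: dvd_imp_le)
    then have "coprime p (Suc m)" by (rule prime_imp_coprime [OF assms(1)])
    then show ?thesis by (simp only: coprime_int_iff coprime_commute)
  qed
  ultimately show ?case by (subst (asm) cong_mult_lcancel) auto
qed auto

text \<open>In Lagrange's recurrence the term \<open>i = 0\<close> is
  \<open>p choose (k + 1)\<close> with \<open>k + 1 < p\<close>, the others are covered by
  induction, and \<open>k\<close> is a unit modulo \<open>p\<close>.\<close>

lemma prime_dvd_stirling_prime:
  assumes "prime p" "1 \<le> k" "k + 2 \<le> p"
  shows "p dvd stirling p (p - k)"
  using assms(2,3)
proof (induction k rule: less_induct)
  case (less k)
  have "p dvd ((p - i) choose (k + 1 - i)) * stirling p (p - i)" if "i < k" for i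
  proof (cases "i = 0")
    case True
    then show ?thesis using assms(1) less.prems by (auto intro!: dvd_choose_prime)
  next
    case False
    then show ?thesis using less that by auto
  qed
  then have "p dvd k * stirling p (p - k)"
    using less.prems by (subst stirling_Lagrange) (auto intro: dvd_sum)
  moreover have "\<not> p dvd k" using less.prems by (auto dest: dvd_imp_le)
  ultimately show ?case using assms(1) by (simp add: prime_dvd_mult_iff)
qed

text \<open>Lagrange's recurrence divided by \<open>p\<close>, with its binomial coefficients
  reduced modulo \<open>p\<close>. The sign and the factor \<open>i\<close> in \<open>b\<close> are
  chosen so that the result is the recurrence of the numbers \<open>- bernoulli i\<close>; compare
  \<open>bernoulli_recurrence\<close>.\<close>

lemma cong_stirling_prime_recurrence:
  fixes p k :: nat
  defines "b \<equiv> \<lambda>i. (- 1) ^ i * int i * int (stirling p (p - i) div p)"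
  assumes p: "prime p" and k: "1 \<le> k" "k + 2 \<le> p"
  shows "[int (k + 1) * b k = 1 - (\<Sum>i\<in>{1..<k}. int ((k + 1) choose i) * b i)] (mod int p)"
proof -
  define \<alpha> where "\<alpha> = (\<lambda>i. int (stirling p (p - i) div p))"
  have \<alpha>: "int (stirling p (p - i)) = int p * \<alpha> i" if "1 \<le> i" "i \<le> k" for i
    using prime_dvd_stirling_prime [OF p, of i] that k unfolding \<alpha>_def of_nat_mult [symmetric] by simp
  have "{..<k} = insert 0 {1..<k}" using k by auto
  then have "int k * int (stirling p (p - k)) = int (p choose (k + 1)) +
      (\<Sum>i\<in>{1..<k}. int ((p - i) choose (k + 1 - i)) * int (stirling p (p - i)))"
    using arg_cong [OF stirling_Lagrange [of k p], of int] k
    by (simp del: binomial_Suc_Suc)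
  also have "(\<Sum>i\<in>{1..<k}. int ((p - i) choose (k + 1 - i)) * int (stirling p (p - i))) =
      int p * (\<Sum>i\<in>{1..<k}. int ((p - i) choose (k + 1 - i)) * \<alpha> i)"
    unfolding sum_distrib_left by (intro sum.cong refl) (use \<alpha> in auto)
  \<comment> \<open>The factor \<open>k + 1\<close> turns \<open>p choose (k + 1)\<close> into
    \<open>p * ((p - 1) choose k)\<close>, so that \<open>p\<close> can be cancelled
    throughout.\<close>
  finally have "int (k + 1) * (int k * (int p * \<alpha> k)) = int (k + 1) * int (p choose (k + 1)) +
      int p * (int (k + 1) * (\<Sum>i\<in>{1..<k}. int ((p - i) choose (k + 1 - i)) * \<alpha> i))"
    using \<alpha> [of k] k by (simp only: distrib_left mult_ac order_refl)
  also have "int (k + 1) * int (p choose (k + 1)) = int p * int ((p - 1) choose k)"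
    using arg_cong [OF binomial_absorption [of k p], of int] by (simp only: of_nat_mult Suc_eq_plus1)
  finally have "int p * (int (k + 1) * (int k * \<alpha> k)) = int p * (int ((p - 1) choose k) +
      int (k + 1) * (\<Sum>i\<in>{1..<k}. int ((p - i) choose (k + 1 - i)) * \<alpha> i))"
    by (simp only: mult_ac distrib_left)
  then have 1: "int (k + 1) * (int k * \<alpha> k) = int ((p - 1) choose k) +
      (\<Sum>i\<in>{1..<k}. int (k + 1) * (int ((p - i) choose (k + 1 - i)) * \<alpha> i))"
    using p by (simp only: mult_cancel_left sum_distrib_left) auto
  define D where "D = (\<lambda>i. (- 1) ^ (k + 1 - i) * int ((i + (k + 1 - i) - 1) choose (k + 1 - i)))"
  have D: "[int ((p - i) choose (k + 1 - i)) = D i] (mod int p)" if "i \<in> {1..<k}" for i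
    unfolding D_def by (rule cong_binomial_prime_diff [OF p]) (use that k in auto)
  have 2: "[int ((p - 1) choose k) = (- 1) ^ k] (mod int p)"
    using cong_binomial_prime_diff [OF p, of 1 k] k by simp
  have 3: "(\<Sum>i\<in>{1..<k}. int (k + 1) * (D i * \<alpha> i)) =
      (\<Sum>i\<in>{1..<k}. - ((- 1) ^ k) * (int ((k + 1) choose i) * b i))"
  proof (intro sum.cong refl)
    fix i assume i: "i \<in> {1..<k}"
    then obtain j where j: "i = Suc j" by (metis atLeastLessThan_iff Suc_le_D One_nat_def)
    \<comment> \<open>This absorption is the source of the factor \<open>i\<close> in
      \<open>b\<close>.\<close>
    have "(k + 1) * (k choose (k + 1 - i)) = i * ((k + 1) choose i)"
      using i binomial_symmetric [of j k] binomial_absorption [of j "k + 1"] by (simp add: j)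
    from arg_cong [OF this, of int]
    have *: "int (k + 1) * int (k choose (k + 1 - i)) = int i * int ((k + 1) choose i)"
      by (simp only: of_nat_mult)
    have sgn: "(- 1 :: int) ^ (k + 1 - i) = - ((- 1) ^ k * (- 1) ^ i)"
      using i by (cases "even i"; cases "even k") auto
    have "int (k + 1) * (D i * \<alpha> i) =
        (- 1) ^ (k + 1 - i) * (int (k + 1) * int (k choose (k + 1 - i))) * \<alpha> i"
      using i by (simp add: D_def mult_ac)
    also have "\<dots> = - ((- 1) ^ k) * (int ((k + 1) choose i) * b i)"
      unfolding * sgn by (simp add: b_def \<alpha>_def mult_ac)
    finally show "int (k + 1) * (D i * \<alpha> i) =
        - ((- 1) ^ k) * (int ((k + 1) choose i) * b i)" .
  qed
  have "[int (k + 1) * (int k * \<alpha> k) =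
      (- 1) ^ k + (\<Sum>i\<in>{1..<k}. int (k + 1) * (D i * \<alpha> i))] (mod int p)"
    unfolding 1 by (intro cong_add 2 cong_sum cong_mult cong_refl D)
  also have "(- 1) ^ k + (\<Sum>i\<in>{1..<k}. int (k + 1) * (D i * \<alpha> i)) =
      (- 1) ^ k * (1 - (\<Sum>i\<in>{1..<k}. int ((k + 1) choose i) * b i))"
    unfolding 3 by (simp only: sum_distrib_left [symmetric]) (simp add: right_diff_distrib)
  finally have "[(- 1) ^ k * (int (k + 1) * (int k * \<alpha> k)) =
      (- 1) ^ k * ((- 1) ^ k * (1 - (\<Sum>i\<in>{1..<k}. int ((k + 1) choose i) * b i)))] (mod int p)"
    by (rule cong_scalar_left)
  moreover have "(- 1) ^ k * ((- 1) ^ k * x) = x" for x :: int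
    by (cases "even k") auto
  moreover have "(- 1) ^ k * (int (k + 1) * (int k * \<alpha> k)) = int (k + 1) * b k"
    by (simp add: b_def \<alpha>_def mult_ac)
  ultimately show ?thesis by (simp only:)
qed

text \<open>\<open>padic_small p x\<close> says that \<open>x\<close> lies in the maximal ideal of the localisation of the
  integers at \<open>p\<close>; no integrality of the Bernoulli numbers has to be known beforehand.\<close>

definition padic_small :: "nat \<Rightarrow> rat \<Rightarrow> bool" where
  "padic_small p x \<longleftrightarrow> (\<exists>d z::int. \<not> int p dvd d \<and> of_int d * x = of_int (int p * z))"

lemma padic_small_of_int: "prime p \<Longrightarrow> padic_small p (of_int (int p * z))"
  unfolding padic_small_def by (rule exI [of _ 1]) (auto dest: not_prime_unit)

lemma padic_small_add:
  assumes "prime p" "padic_small p x" "padic_small p y"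
  shows "padic_small p (x + y)"
proof -
  obtain d z e w where "\<not> int p dvd d" "of_int d * x = of_int (int p * z)"
    and "\<not> int p dvd e" "of_int e * y = of_int (int p * w)"
    using assms(2,3) unfolding padic_small_def by blast
  then have "\<not> int p dvd d * e" "of_int (d * e) * (x + y) = of_int (int p * (z * e + w * d))"
    using assms(1) by (auto simp: prime_dvd_mult_iff algebra_simps)
  then show ?thesis unfolding padic_small_def by blast
qed

lemma padic_small_mult_int:
  assumes "padic_small p x"
  shows "padic_small p (of_int c * x)"
proof -
  obtain d z where "\<not> int p dvd d" "of_int d * x = of_int (int p * z)"
    using assms unfolding padic_small_def by blast
  then have "\<not> int p dvd d" "of_int d * (of_int c * x) = of_int (int p * (c * z))"
    by (auto simp: algebra_simps)
  then show ?thesis unfolding padic_small_def by blast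
qed

lemma padic_small_sum:
  assumes "prime p" "\<And>i. i \<in> A \<Longrightarrow> padic_small p (f i)"
  shows "padic_small p (\<Sum>i\<in>A. f i)"
  using assms(2)
  by (induction A rule: infinite_finite_induct)
    (use padic_small_of_int [OF assms(1), of 0] in \<open>auto intro: padic_small_add [OF assms(1)]\<close>)

lemma padic_small_cancel_int:
  assumes "prime p" "padic_small p (of_int c * x)" "\<not> int p dvd c"
  shows "padic_small p x"
proof -
  obtain d z where "\<not> int p dvd d" "of_int d * (of_int c * x) = of_int (int p * z)"
    using assms unfolding padic_small_def by blast
  then have "\<not> int p dvd d * c" "of_int (d * c) * x = of_int (int p * z)"
    using assms(1,3) by (auto simp: prime_dvd_mult_iff algebra_simps)
  then show ?thesis unfolding padic_small_def by blast
qed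

text \<open>Adding the two recurrences expresses \<open>k + 1\<close> times the claimed sum through
  earlier sums and a multiple of \<open>p\<close>; \<open>k + 1 < p\<close> is a unit.\<close>

lemma bernoulli_stirling_prime:
  assumes p: "prime p" and k: "1 \<le> k" "k + 2 \<le> p"
  shows "padic_small p (bernoulli k + of_int ((- 1) ^ k * int k * int (stirling p (p - k) div p)))"
  using k
proof (induction k rule: less_induct)
  case (less k)
  define b where "b = (\<lambda>i. (- 1) ^ i * int i * int (stirling p (p - i) div p))"
  have IH: "padic_small p (bernoulli i + of_int (b i))" if "i \<in> {1..<k}" for i
    unfolding b_def by (rule less.IH) (use that less.prems in auto)
  have "\<exists>z. int (k + 1) * b k = 1 - (\<Sum>i\<in>{1..<k}. int ((k + 1) choose i) * b i) + int p * z"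
    unfolding b_def
    by (rule iffD1 [OF cong_iff_lin, OF cong_sym [OF cong_stirling_prime_recurrence [OF p less.prems]]])
  then obtain z where z: "int (k + 1) * b k =
      1 - (\<Sum>i\<in>{1..<k}. int ((k + 1) choose i) * b i) + int p * z" ..
  have "of_int (int (k + 1)) * (bernoulli k + of_int (b k)) =
      of_nat (k + 1) * bernoulli k + (of_int (int (k + 1) * b k) :: rat)"
    by (simp add: algebra_simps)
  also have "\<dots> = (\<Sum>i\<in>{1..<k}. of_int (- int ((k + 1) choose i)) * (bernoulli i + of_int (b i))) +
      of_int (int p * z)"
    unfolding bernoulli_recurrence [OF less.prems(1)] z
    by (simp add: distrib_left sum.distrib sum_negf sum_subtractf del: binomial_Suc_Suc)
  also have "padic_small p \<dots>"
    by (rule padic_small_add [OF p padic_small_sum [OF p padic_small_mult_int [OF IH]]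
          padic_small_of_int [OF p]])
  finally show ?case
    unfolding b_def
    by (rule padic_small_cancel_int [OF p]) (use less.prems in \<open>auto dest: dvd_imp_le simp del: of_nat_Suc\<close>)
qed

text \<open>Write \<open>stirling p (p - k) = p * A\<close>. For even \<open>k\<close> the Bernoulli
  number is \<open>- k * A\<close> modulo \<open>p\<close>, and \<open>k\<close> is a unit, so
  \<open>p\<close> divides \<open>A\<close> exactly when \<open>p\<close> divides the
  numerator.\<close>

lemma prime_square_dvd_stirling_iff:
  assumes p: "prime p" and k: "2 \<le> k" "k + 2 \<le> p" "even k"
  shows "p ^ 2 dvd stirling p (p - k) \<longleftrightarrow> padic_val p (bernoulli k) \<noteq> 0"
proof -
  define A where "A = stirling p (p - k) div p"
  have A: "stirling p (p - k) = p * A"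
    using prime_dvd_stirling_prime [OF p, of k] k by (simp add: A_def)
  obtain d z where d: "\<not> int p dvd d"
    and "of_int d * (bernoulli k + of_int ((- 1) ^ k * int k * int A)) = of_int (int p * z)"
    using bernoulli_stirling_prime [OF p, of k] k unfolding padic_small_def A_def by auto
  then have eq: "of_int d * bernoulli k = of_int (int p * z - d * int k * int A)"
    using k(3) by (simp add: algebra_simps)
  have "d \<noteq> 0" using d by auto
  then have B: "bernoulli k = of_int (int p * z - d * int k * int A) / of_int d"
    unfolding eq [symmetric] by simp
  \<comment> \<open>Since \<open>padic_val p 0 = 0\<close>, a vanishing Bernoulli number would pass
    for a unit; this excludes it.\<close>
  have nz: "int p * z - d * int k * int A \<noteq> 0"
  proof
    assume "int p * z - d * int k * int A = 0"
    with B have "bernoulli k = 0" by (simp only: of_int_0 div_0)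
    with bernoulli_even_nonzero [of k] k show False by simp
  qed
  have "padic_val p (bernoulli k) = int (multiplicity (int p) (int p * z - d * int k * int A))"
    unfolding B using p nz \<open>d \<noteq> 0\<close> d by (subst padic_val_divide) (simp_all add: not_dvd_imp_multiplicity_0)
  then have "padic_val p (bernoulli k) \<noteq> 0 \<longleftrightarrow> int p dvd int p * z - d * int k * int A"
    using p nz by (simp add: prime_multiplicity_gt_zero_iff)
  also have "\<dots> \<longleftrightarrow> int p dvd d * int k * int A" 
    using dvd_add_right_iff [of "int p" "int p * z" "- (d * int k * int A)"] by simp
  also have "\<dots> \<longleftrightarrow> p dvd A"
  proof -
    have "\<not> int p dvd int k" using k by (auto dest: dvd_imp_le)
    then show ?thesis using p d by (simp add: prime_dvd_mult_iff)
  qed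
  also have "\<dots> \<longleftrightarrow> p ^ 2 dvd stirling p (p - k)"
    using p by (simp add: A power2_eq_square)
  finally show ?thesis by simp
qed

section \<open>The rising factorial modulo the square of a prime\<close>

lemma of_nat_poly_dvd_iff:
  "(of_nat c :: int poly) dvd g \<longleftrightarrow> (\<forall>n. int c dvd coeff g n)"
  by (simp add: of_nat_poly const_poly_dvd_iff)

lemma coeff_of_nat_mult: "coeff (of_nat c * g) n = of_nat c * coeff (g :: 'a::comm_semiring_1 poly) n"
  by (simp add: of_nat_poly)

text \<open>Lagrange's congruence modulo \<open>p\<close>, with \<open>h\<close> as the quotient. In
  degree 1 the summand \<open>- x\<close> interferes, hence \<open>m + 2 \<le> p\<close> in the last
  clause.\<close>

lemma pochhammer_prime_decomposition:
  fixes p :: nat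
  assumes p: "prime p" "3 \<le> p"
  obtains h :: "int poly"
  where "pochhammer [:0, 1:] p = [:0, 1:] ^ p - [:0, 1:] + of_nat p * h"
    and "\<And>j. j = 0 \<or> p \<le> j \<Longrightarrow> coeff h j = 0"
    and "\<And>m. 1 \<le> m \<Longrightarrow> m + 2 \<le> p \<Longrightarrow> int (stirling p (p - m)) = int p * coeff h (p - m)"
proof -
  let ?X = "[:0, 1:] :: int poly"
  let ?g = "pochhammer ?X p - (?X ^ p - ?X)"
  have Xp: "coeff (?X ^ p) j = (if j = p then 1 else 0)" for j
    by (auto simp: coeff_linear_poly_power' binomial_eq_0 power_0_left not_less)
  have X: "coeff ?X j = (if j = 1 then 1 else 0)" for j
    by (auto simp: coeff_pCons split: nat.splits)
  have g: "coeff ?g j = int (stirling p j) - (if j = p then 1 else 0) + (if j = 1 then 1 else 0)" for j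
    by (simp add: coeff_pochhammer_X Xp X)
  have "int p dvd coeff ?g j" for j
  proof -
    consider "j = 0" | "j = 1" | "2 \<le> j" "j < p" | "p \<le> j" by linarith
    then show ?thesis
    proof cases
      case 1
      then show ?thesis using p unfolding g by simp
    next
      case 2
      \<comment> \<open>Lagrange's recurrence with \<open>k = p - 1\<close> yields Wilson's theorem
        in the form \<open>stirling p 1 = - 1\<close> modulo \<open>p\<close>.\<close>
      have "{..<p - 1} = insert 0 {1..<p - 1}" using p by auto
      then have "(p - 1) * stirling p 1 = 1 + (\<Sum>i\<in>{1..<p - 1}. stirling p (p - i))"
        using stirling_Lagrange [of "p - 1" p] p by simp
      from arg_cong [OF this, of int]
      have "int (stirling p 1) + 1 = int p * int (stirling p 1) - int (\<Sum>i\<in>{1..<p - 1}. stirling p (p - i))"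
        using p by (simp add: of_nat_diff algebra_simps)
      moreover have "p dvd (\<Sum>i\<in>{1..<p - 1}. stirling p (p - i))"
        by (intro dvd_sum prime_dvd_stirling_prime p) auto
      then have "int p dvd int (\<Sum>i\<in>{1..<p - 1}. stirling p (p - i))" by (simp only: int_dvd_int_iff)
      ultimately have "int p dvd int (stirling p 1) + 1" by (simp only: dvd_diff dvd_triv_left)
      then show ?thesis using 2 p unfolding g by simp
    next
      case 3
      then show ?thesis using prime_dvd_stirling_prime [OF p(1), of "p - j"] unfolding g by simp
    next
      case 4
      then show ?thesis using p unfolding g by (cases "j = p") auto
    qed
  qed
  then have "of_nat p dvd ?g" by (simp only: of_nat_poly_dvd_iff) auto
  then obtain h where h: "?g = of_nat p * h" by (elim dvdE)
  have h': "int p * coeff h j = coeff ?g j" for j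
    unfolding h coeff_of_nat_mult ..
  show ?thesis
  proof
    show "pochhammer ?X p = ?X ^ p - ?X + of_nat p * h" using h by (simp add: algebra_simps)
    show "coeff h j = 0" if "j = 0 \<or> p \<le> j" for j
    proof -
      have "int p * coeff h j = 0"
        using that p unfolding h' g by (cases "j = p") auto
      then show ?thesis using p by simp
    qed
    show "int (stirling p (p - m)) = int p * coeff h (p - m)" if "1 \<le> m" "m + 2 \<le> p" for m
      using that unfolding h' g by auto
  qed
qed

lemma pcompose_pochhammer:
  "pcompose (pochhammer f n) g = pochhammer (pcompose f g) n" for f g :: "'a::comm_ring_1 poly"
  by (induction n) (simp_all add: pochhammer_Suc pcompose_mult pcompose_add of_nat_poly pcompose_1)

lemma pcompose_shift_cong:
  "[:c:] dvd pcompose g [:c, 1:] - g" for g :: "'a::comm_ring_1 poly"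
proof (induction g)
  case (pCons a g)
  have "pcompose (pCons a g) [:c, 1:] - pCons a g =
      [:0, 1:] * (pcompose g [:c, 1:] - g) + [:c:] * pcompose g [:c, 1:]"
    by (simp add: pcompose_pCons algebra_simps)
  with pCons.IH show ?case by (metis dvd_add dvd_mult dvd_triv_left)
qed simp

text \<open>The middle terms get one factor \<open>p\<close> from the binomial coefficient and one
  from \<open>b * p\<close>; the constant term contains \<open>p^p\<close>.\<close>

lemma linear_power_prime_cong:
  assumes "prime p"
  shows "(of_nat p ^ 2 :: int poly) dvd [:int (b * p), 1:] ^ p - [:0, 1:] ^ p"
  unfolding of_nat_power [symmetric] of_nat_poly_dvd_iff
proof
  fix j
  have *: "coeff ([:int (b * p), 1:] ^ p - [:0, 1:] ^ p) j =
      int (p choose j) * (int (b * p) ^ (p - j) - 0 ^ (p - j))"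
    by (simp add: coeff_linear_poly_power' algebra_simps)
  consider "j = 0" | "1 \<le> j" "j < p" | "p \<le> j" by linarith
  then show "int (p ^ 2) dvd coeff ([:int (b * p), 1:] ^ p - [:0, 1:] ^ p) j"
  proof cases
    case 1
    have "int p ^ 2 dvd int p ^ p" using prime_ge_2_nat [OF assms] by (rule le_imp_power_dvd)
    then show ?thesis using assms 1 unfolding * by (simp add: power_mult_distrib zero_power prime_gt_0_nat)
  next
    case 2
    then have "int p dvd int (p choose j)" using assms by (simp add: dvd_choose_prime)
    moreover have "int (b * p) dvd int (b * p) ^ (p - j)" using 2 by (intro dvd_power) simp
    then have "int p dvd int (b * p) ^ (p - j)" by (rule dvd_trans [rotated]) simp
    then have "int p dvd int (b * p) ^ (p - j) - 0 ^ (p - j)"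
      using 2 by (simp only: power_0_left) simp
    ultimately have "int p * int p dvd int (p choose j) * (int (b * p) ^ (p - j) - 0 ^ (p - j))"
      by (rule mult_dvd_mono)
    moreover have "int (p ^ 2) = int p * int p" by (simp add: power2_eq_square)
    ultimately show ?thesis by (simp only: *)
  next
    case 3
    then show ?thesis unfolding * by simp
  qed
qed

text \<open>Under the shift by \<open>b * p\<close> both \<open>x^p\<close> and \<open>p * h\<close>
  are unchanged modulo \<open>p^2\<close>, so only the summand \<open>- x\<close> contributes,
  namely \<open>- b * p\<close>.\<close>

lemma pochhammer_shift_prime_cong:
  fixes h :: "int poly"
  assumes p: "prime p"
    and h: "pochhammer [:0, 1:] p = [:0, 1:] ^ p - [:0, 1:] + of_nat p * h"
  shows "of_nat p ^ 2 dvd pochhammer [:int (b * p), 1:] p -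
    ([:0, 1:] ^ p - [:0, 1:] + of_nat p * (h - of_nat b))"
proof -
  let ?X = "[:0, 1:] :: int poly" and ?Y = "[:int (b * p), 1:]"
  have pow: "pcompose (f ^ n) g = pcompose f g ^ n" for f g :: "int poly" and n
    by (induction n) (simp_all add: pcompose_mult pcompose_1)
  have "pochhammer ?Y p = pcompose (pochhammer ?X p) ?Y"
    by (simp add: pcompose_pochhammer pcompose_pCons)
  also have "\<dots> = ?Y ^ p - ?Y + of_nat p * pcompose h ?Y"
    unfolding h by (simp add: pcompose_add pcompose_diff pcompose_mult pow pcompose_smult
        pcompose_pCons of_nat_poly)
  also have "?Y = ?X + of_nat p * of_nat b"
    by (simp add: of_nat_poly)
  finally have eq: "pochhammer ?Y p - (?X ^ p - ?X + of_nat p * (h - of_nat b)) =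
      (?Y ^ p - ?X ^ p) + of_nat p * (pcompose h ?Y - h)"
    by (simp add: algebra_simps of_nat_poly)
  have "(of_nat p :: int poly) dvd [:int (b * p):]" by (simp add: of_nat_poly)
  then have "of_nat p dvd pcompose h ?Y - h"
    using pcompose_shift_cong dvd_trans by blast
  then have "of_nat p ^ 2 dvd of_nat p * (pcompose h ?Y - h)"
    by (simp add: power2_eq_square mult_dvd_mono)
  then show ?thesis unfolding eq by (intro dvd_add linear_power_prime_cong p)
qed

text \<open>The block shifted by \<open>b * p\<close> is \<open>u + p * (h - b)\<close> modulo
  \<open>p^2\<close>. In the product of the blocks the shifts add up to the constant
  \<open>c\<close>.\<close>

lemma pochhammer_multiple_cong:
  fixes h :: "int poly" and p :: nat
  defines "u \<equiv> [:0, 1:] ^ p - [:0, 1:]"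
  assumes p: "prime p" and h: "pochhammer [:0, 1:] p = u + of_nat p * h"
  shows "\<exists>c. of_nat p ^ 2 dvd pochhammer [:0, 1:] (Suc a * p) -
    (u ^ Suc a + of_nat p * ((of_nat (Suc a) * h + [:c:]) * u ^ a))"
proof (induction a)
  case 0
  show ?case by (rule exI [of _ 0]) (simp add: h)
next
  case (Suc a)
  let ?P = "of_nat p :: int poly"
  from Suc.IH obtain c where c: "?P ^ 2 dvd pochhammer [:0, 1:] (Suc a * p) -
    (u ^ Suc a + ?P * ((of_nat (Suc a) * h + [:c:]) * u ^ a))" by blast
  define A A' B B' :: "int poly" where "A = pochhammer [:0, 1:] (Suc a * p)"
    and "A' = u ^ Suc a + ?P * ((of_nat (Suc a) * h + [:c:]) * u ^ a)"
    and "B = pochhammer [:int (Suc a * p), 1:] p" and "B' = u + ?P * (h - of_nat (Suc a))"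
  define c' where "c' = c - int (Suc a)"
  have c': "[:c':] = [:c:] - of_nat (Suc a)" by (simp add: c'_def of_nat_poly)
  have "pochhammer [:0, 1:] (Suc (Suc a) * p) = (pochhammer [:0, 1:] (Suc a * p + p) :: int poly)"
    by (simp add: add.commute)
  also have "\<dots> = A * B"
    unfolding pochhammer_product' A_def B_def by (simp add: of_nat_poly)
  finally have AB: "pochhammer [:0, 1:] (Suc (Suc a) * p) = A * B" .
  have "?P ^ 2 dvd A - A'" using c by (simp add: A_def A'_def)
  moreover have "?P ^ 2 dvd B - B'"
    unfolding B_def B'_def u_def using p h [unfolded u_def] by (rule pochhammer_shift_prime_cong)
  \<comment> \<open>The last summand is the product of the two \<open>p\<close>-terms of
    \<open>A'\<close> and \<open>B'\<close>, which is dropped modulo \<open>p^2\<close>.\<close>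
  ultimately have "?P ^ 2 dvd A * (B - B') + B' * (A - A') +
      ?P ^ 2 * ((of_nat (Suc a) * h + [:c:]) * (h - of_nat (Suc a)) * u ^ a)" (is "_ dvd ?rhs")
    by (intro dvd_add dvd_mult dvd_triv_left)
  also have "?rhs = A * B -
      (u ^ Suc (Suc a) + ?P * ((of_nat (Suc (Suc a)) * h + [:c':]) * u ^ Suc a))"
    unfolding A'_def B'_def c' of_nat_Suc power_Suc power2_eq_square by algebra
  finally show ?case unfolding AB by blast
qed

section \<open>Coefficients of products with powers of \<open>x^p - x\<close>\<close>

lemma coeff_mult_power_binomial:
  fixes g :: "int poly"
  assumes "1 \<le> p"
  shows "coeff (g * ([:0, 1:] ^ p - [:0, 1:]) ^ a) N =
    (\<Sum>i\<le>a. if N < i + p * (a - i) then 0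
      else (- 1) ^ i * int (a choose i) * coeff g (N - (i + p * (a - i))))"
proof -
  have X: "[:0, 1:] = (monom 1 1 :: int poly)" by (simp add: monom_altdef)
  have "([:0, 1:] ^ p - [:0, 1:]) ^ a = (- monom 1 1 + monom 1 p :: int poly) ^ a"
    unfolding X by (simp add: monom_power)
  also have "\<dots> = (\<Sum>i\<le>a. of_nat (a choose i) * (- monom 1 1) ^ i * monom 1 p ^ (a - i))"
    by (rule binomial_ring)
  also have "\<dots> = (\<Sum>i\<le>a. monom ((- 1) ^ i * int (a choose i)) (i + p * (a - i)))"
  proof (intro sum.cong refl)
    fix i
    have "- monom 1 1 = (monom (- 1) 1 :: int poly)" by (simp add: minus_monom)
    then show "of_nat (a choose i) * (- monom 1 1) ^ i * monom 1 p ^ (a - i) =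
        monom ((- 1) ^ i * int (a choose i)) (i + p * (a - i))"
      by (simp add: monom_power mult_monom of_nat_monom mult_ac add.commute)
  qed
  finally show ?thesis
    by (simp add: sum_distrib_left coeff_sum mult.commute [of g] coeff_monom_mult cong: if_cong)
qed

lemma mult_split_index:
  fixes p a i :: nat
  assumes "1 \<le> p" "i \<le> a"
  shows "a * p = i * (p - 1) + (i + p * (a - i))"
proof -
  obtain r q where "a = i + r" "p = Suc q"
    using assms le_Suc_ex [of i a] le_Suc_ex [of 1 p] by auto
  then show ?thesis by (simp add: algebra_simps)
qed

text \<open>The \<open>i\<close>-th binomial term has degree \<open>a * p - i * (p - 1)\<close>, so
  only \<open>i = k div (p - 1)\<close> can contribute. For \<open>i > a\<close> the binomial
  coefficient on the right is zero.\<close>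

lemma coeff_binomial_power:
  fixes p k a :: nat
  assumes "2 \<le> p" "k < a * p"
  shows "coeff (([:0, 1:] ^ p - [:0, 1:]) ^ a :: int poly) (a * p - k) =
    (if p - 1 dvd k then (- 1) ^ (k div (p - 1)) * int (a choose (k div (p - 1))) else 0)"
proof -
  have index: "M - k - e = 0 \<and> e \<le> M - k \<longleftrightarrow> k = x" if "M = x + e" "k < M" for M x e :: nat
    using that by auto
  have eq: "a * p - k - (i + p * (a - i)) = 0 \<and> i + p * (a - i) \<le> a * p - k \<longleftrightarrow> k = i * (p - 1)"
    if "i \<le> a" for i
    by (rule index) (use mult_split_index [of p i a] assms that in linarith)+
  have "coeff (1 * ([:0, 1:] ^ p - [:0, 1:]) ^ a :: int poly) (a * p - k) =
      (\<Sum>i\<le>a. if k = i * (p - 1) then (- 1) ^ i * int (a choose i) else 0)"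
    unfolding coeff_mult_power_binomial [OF order.trans [OF one_le_numeral assms(1)]]
  proof (intro sum.cong refl)
    fix i assume "i \<in> {..a}"
    then show "(if a * p - k < i + p * (a - i) then 0
        else (- 1) ^ i * int (a choose i) * coeff 1 (a * p - k - (i + p * (a - i)))) =
      (if k = i * (p - 1) then (- 1) ^ i * int (a choose i) else 0)"
      using eq [of i] by (simp only: atMost_iff coeff_1 not_less [symmetric]) (auto split: if_splits)
  qed
  also have "\<dots> = (\<Sum>i\<le>a. if i = k div (p - 1) then
      (if p - 1 dvd k then (- 1) ^ i * int (a choose i) else 0) else 0)"
    using assms(1) by (intro sum.cong refl) (auto simp: dvd_def)
  also have "\<dots> = (if p - 1 dvd k then (- 1) ^ (k div (p - 1)) * int (a choose (k div (p - 1))) else 0)"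
    by (auto simp: binomial_eq_0)
  finally show ?thesis by simp
qed

text \<open>The degrees of \<open>h\<close> lie between 1 and \<open>p - 1\<close>, while the
  exponents of the power are spaced by \<open>p - 1\<close>. With \<open>k = i * (p - 1) + m\<close>
  and \<open>1 \<le> m < p - 1\<close>, the \<open>i\<close>-th term meets \<open>h\<close> in
  degree \<open>p - m\<close>; smaller \<open>r\<close> would need degree at most 0, larger
  \<open>r\<close> at least \<open>p\<close>.\<close>

lemma coeff_mult_binomial_power:
  fixes p k a :: nat and h :: "int poly"
  assumes "2 \<le> p" and h: "\<And>j. j = 0 \<or> p \<le> j \<Longrightarrow> coeff h j = 0"
    and k: "k < Suc a * (p - 1)" "\<not> p - 1 dvd k"
  shows "coeff (h * ([:0, 1:] ^ p - [:0, 1:]) ^ a) (Suc a * p - k) =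
    (- 1) ^ (k div (p - 1)) * int (a choose (k div (p - 1))) * coeff h (p - k mod (p - 1))"
proof -
  define q i m where "q = p - 1" and "i = k div q" and "m = k mod q"
  have p: "p = Suc q" and q: "0 < q" using assms(1) by (auto simp: q_def)
  have km: "k = i * q + m" by (simp add: i_def m_def)
  have m: "1 \<le> m" "m < q" using k(2) q by (auto simp: m_def q_def mod_greater_zero_iff_not_dvd Suc_le_eq)
  have ia: "i \<le> a"
    using k(1) unfolding i_def q_def by (metis less_Suc_eq_le less_mult_imp_div_less)
  have split_index: "Suc a * p = r * q + (r + p * (a - r)) + p" if "r \<le> a" for r
    using mult_split_index [of p r a] that p by simp
  let ?f = "\<lambda>r. if Suc a * p - k < r + p * (a - r) then 0
      else (- 1) ^ r * int (a choose r) * coeff h (Suc a * p - k - (r + p * (a - r)))"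
  have "?f r = 0" if r: "r \<le> a" "r \<noteq> i" for r
  proof (cases "r < i")
    case True
    then obtain d where d: "i = r + Suc d" using less_iff_Suc_add by auto
    have "i * q = r * q + q + d * q" by (simp add: d algebra_simps)
    then have "Suc a * p - k \<le> r + p * (a - r)"
      using split_index [OF r(1)] m km p by linarith
    then show ?thesis using h by auto
  next
    case False
    then obtain d where d: "r = i + Suc d" using r less_iff_Suc_add [of i r] by auto
    have "r * q = i * q + q + d * q" by (simp add: d algebra_simps)
    then have "p \<le> Suc a * p - k - (r + p * (a - r))"
      using split_index [OF r(1)] m km p by linarith
    then show ?thesis using h by auto
  qed
  then have "(\<Sum>r\<le>a. ?f r) = (\<Sum>r\<in>{i}. ?f r)"
    using ia by (intro sum.mono_neutral_right) auto
  also have "\<dots> = ?f i" by simp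
  also have "\<dots> = (- 1) ^ i * int (a choose i) * coeff h (p - m)"
  proof -
    have "Suc a * p - k = (i + p * (a - i)) + (p - m)"
      using split_index [OF ia] m km p by linarith
    then show ?thesis by simp
  qed
  finally show ?thesis
    unfolding i_def m_def q_def
    using coeff_mult_power_binomial [of p h a "Suc a * p - k"] assms(1) by simp
qed

section \<open>Divisibility of \<open>s(ap, ap - k)\<close> by powers of \<open>p\<close>\<close>

lemma prime_not_dvd_binomial: "prime p \<Longrightarrow> n < p \<Longrightarrow> k \<le> n \<Longrightarrow> \<not> p dvd (n choose k)" for p n k :: nat
  by (metis binomial_fact_lemma dvd_mult not_le prime_dvd_fact_iff)

text \<open>Coefficient comparison in \<open>pochhammer_multiple_cong\<close>; for even
  \<open>k\<close> the unknown constant \<open>c\<close> drops out.\<close>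

lemma stirling_multiple_coeff:
  fixes p a k :: nat and h :: "int poly"
  defines "u \<equiv> [:0, 1:] ^ p - [:0, 1:]"
  assumes p: "prime p" "3 \<le> p" and h: "pochhammer [:0, 1:] p = u + of_nat p * h"
    and k: "even k" "k < Suc a * p"
  shows "int (p ^ 2) dvd int (stirling (Suc a * p) (Suc a * p - k)) -
    (coeff (u ^ Suc a) (Suc a * p - k) + int p * (int (Suc a) * coeff (h * u ^ a) (Suc a * p - k)))"
proof -
  let ?N = "Suc a * p - k"
  obtain c where "of_nat p ^ 2 dvd pochhammer [:0, 1:] (Suc a * p) -
    (u ^ Suc a + of_nat p * ((of_nat (Suc a) * h + [:c:]) * u ^ a))"
    using pochhammer_multiple_cong [OF p(1) h [unfolded u_def], of a] unfolding u_def by blast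
  then have "int (p ^ 2) dvd coeff (pochhammer [:0, 1:] (Suc a * p) -
    (u ^ Suc a + of_nat p * ((of_nat (Suc a) * h + [:c:]) * u ^ a))) ?N"
    unfolding of_nat_power [symmetric] of_nat_poly_dvd_iff by blast
  \<comment> \<open>If \<open>p \<le> k\<close>, then \<open>k - p\<close> is odd, hence no multiple
    of the even number \<open>p - 1\<close>; otherwise the index exceeds the degree
    \<open>a * p\<close>.\<close>
  moreover have "coeff (u ^ a) ?N = 0"
  proof (cases "p \<le> k")
    case True
    then obtain l where l: "k = p + l" using le_Suc_ex by blast
    have "odd p" using p prime_odd_nat [of p] by simp
    then have "\<not> p - 1 dvd l" using k(1) p by (auto simp: l elim!: dvdE)
    moreover have "l < a * p" "?N = a * p - l" using k(2) by (simp_all add: l)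
    ultimately show ?thesis using coeff_binomial_power [of p l a] p by (simp add: u_def)
  next
    case False
    have "degree u \<le> p"
      unfolding u_def using p by (intro degree_diff_le order.trans [OF degree_power_le]) auto
    then have "degree (u ^ a) \<le> p * a"
      by (intro order.trans [OF degree_power_le] mult_le_mono1)
    also have "\<dots> < ?N" using False by (simp add: mult.commute)
    finally show ?thesis by (rule coeff_eq_0)
  qed
  ultimately show ?thesis
    by (simp only: coeff_diff coeff_add coeff_of_nat_mult coeff_pochhammer_X distrib_right mult.assoc
        mult_pCons_left mult_zero_left pCons_0_0 coeff_smult mult_zero_right add_0_right of_nat_id)
qed

text \<open>Modulo \<open>p\<close> the number is, up to sign,
  \<open>a choose (k div (p - 1))\<close>, a unit because \<open>a < p\<close>.\<close>

lemma stirling_even_unit: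
  fixes p a k :: nat
  assumes p: "prime p" "3 \<le> p" and a: "1 \<le> a" "a < p"
    and k: "even k" "k < a * p" "p - 1 dvd k"
  shows "\<not> p dvd stirling (a * p) (a * p - k)"
proof -
  obtain h :: "int poly" where h: "pochhammer [:0, 1:] p = [:0, 1:] ^ p - [:0, 1:] + of_nat p * h"
    using pochhammer_prime_decomposition [OF p] by blast
  obtain b where b: "a = Suc b" using a by (cases a) auto
  define i where "i = k div (p - 1)"
  have "i * (p - 1) < a * p" using k by (simp add: i_def)
  also have "a * p \<le> Suc a * (p - 1)" using a by (cases p) auto
  finally have "i * (p - 1) < Suc a * (p - 1)" .
  then have "i \<le> a" by (simp only: mult_less_cancel2 less_Suc_eq_le)
  have "int p dvd int (p ^ 2)" by simp
  also note stirling_multiple_coeff [OF p h k(1), of b, folded b, OF k(2)]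
  finally have *: "int p dvd int (stirling (a * p) (a * p - k)) -
      (coeff (([:0, 1:] ^ p - [:0, 1:]) ^ a) (a * p - k) + int p *
        (int a * coeff (h * ([:0, 1:] ^ p - [:0, 1:]) ^ b) (a * p - k)))" .
  show ?thesis
  proof
    assume "p dvd stirling (a * p) (a * p - k)"
    then have "int p dvd int (stirling (a * p) (a * p - k))" by simp
    from dvd_diff [OF this *]
    have "int p dvd coeff (([:0, 1:] ^ p - [:0, 1:]) ^ a) (a * p - k)"
      by (simp add: dvd_add_left_iff)
    then have "int p dvd (- 1) ^ i * int (a choose i)"
      using k p by (subst (asm) coeff_binomial_power) (auto simp: i_def)
    then have "p dvd (a choose i)" by (cases "even i") auto
    with prime_not_dvd_binomial [OF p(1) a(2) \<open>i \<le> a\<close>] show False ..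
  qed
qed

text \<open>As \<open>p - 1\<close> does not divide \<open>k\<close>, the power of \<open>u\<close>
  contributes nothing, and the term with \<open>h\<close> is a unit \<open>C\<close> times
  \<open>stirling p (p - m)\<close>.\<close>

lemma stirling_even_nonunit:
  fixes p a k :: nat
  assumes p: "prime p" "3 \<le> p" and a: "1 \<le> a" "a < p"
    and k: "even k" "k < a * (p - 1)" "\<not> p - 1 dvd k"
  shows "p dvd stirling (a * p) (a * p - k)"
    and "p ^ 2 dvd stirling (a * p) (a * p - k) \<longleftrightarrow> p ^ 2 dvd stirling p (p - k mod (p - 1))"
proof -
  obtain h :: "int poly" where h: "pochhammer [:0, 1:] p = [:0, 1:] ^ p - [:0, 1:] + of_nat p * h"
    and h0: "\<And>j. j = 0 \<or> p \<le> j \<Longrightarrow> coeff h j = 0"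
    and hm: "\<And>m. 1 \<le> m \<Longrightarrow> m + 2 \<le> p \<Longrightarrow> int (stirling p (p - m)) = int p * coeff h (p - m)"
    using pochhammer_prime_decomposition [OF p] by blast
  obtain b where b: "a = Suc b" using a by (cases a) auto
  define i m where "i = k div (p - 1)" and "m = k mod (p - 1)"
  have kp: "k < a * p" using k(2) by (rule less_le_trans) simp
  have "m < p - 1" "m \<noteq> 0" using k(3) p by (auto simp: m_def dvd_eq_mod_eq_0)
  then have m: "1 \<le> m" "m + 2 \<le> p" by auto
  define C where "C = int a * ((- 1) ^ i * int (b choose i))"
  have "i \<le> b"
    using k(2) unfolding i_def b by (metis less_Suc_eq_le less_mult_imp_div_less)
  then have "\<not> p dvd (b choose i)" using prime_not_dvd_binomial [OF p(1), of b i] a b by simp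
  moreover have "\<not> p dvd a" using a by (auto dest: dvd_imp_le)
  ultimately have "\<not> int p dvd C"
    using p(1) unfolding C_def by (cases "even i") (auto simp: prime_dvd_mult_iff)
  then have cop: "coprime (int p ^ e) C" for e
    using prime_imp_coprime [of "int p" C] p(1) by (simp add: coprime_power_left_iff)
  have D: "int (p ^ 2) dvd int (stirling (a * p) (a * p - k)) - C * int (stirling p (p - m))"
  proof -
    have "coeff (([:0, 1:] ^ p - [:0, 1:]) ^ a :: int poly) (a * p - k) = 0"
      using p k kp by (subst coeff_binomial_power) auto
    moreover have "coeff (h * ([:0, 1:] ^ p - [:0, 1:]) ^ b) (a * p - k) =
        (- 1) ^ i * int (b choose i) * coeff h (p - m)"
      unfolding b i_def m_def
      using p h0 k by (intro coeff_mult_binomial_power) (auto simp: b)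
    ultimately show ?thesis
      using stirling_multiple_coeff [OF p h k(1), of b, folded b, OF kp]
      unfolding hm [OF m] C_def by (simp add: mult_ac)
  qed
  have iff: "p ^ e dvd stirling (a * p) (a * p - k) \<longleftrightarrow> p ^ e dvd stirling p (p - m)"
    if "e \<le> 2" for e
  proof -
    have "int p ^ e dvd int (p ^ 2)" using that by (simp add: le_imp_power_dvd)
    from dvd_trans [OF this D]
    have "int p ^ e dvd int (stirling (a * p) (a * p - k)) \<longleftrightarrow> int p ^ e dvd C * int (stirling p (p - m))"
      by (metis dvd_add_left_iff diff_add_cancel dvd_add_right_iff)
    also have "\<dots> \<longleftrightarrow> int p ^ e dvd int (stirling p (p - m))"
      using cop by (rule coprime_dvd_mult_right_iff)
    finally show ?thesis by (simp only: of_nat_power [symmetric] int_dvd_int_iff)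
  qed
  from iff [of 1] prime_dvd_stirling_prime [OF p(1) m]
  show "p dvd stirling (a * p) (a * p - k)" by simp
  from iff [of 2]
  show "p ^ 2 dvd stirling (a * p) (a * p - k) \<longleftrightarrow> p ^ 2 dvd stirling p (p - k mod (p - 1))"
    by (simp add: m_def)
qed

text \<open>Induction over the blocks \<open>Q\<close> of \<open>p\<close> factors. In the
  convolution the term \<open>i = j\<close> gains a factor \<open>p\<close> from the constant
  coefficient of \<open>Q\<close>; for \<open>i < j\<close> the exponent \<open>a - i\<close> is
  already large enough.\<close>

lemma power_dvd_stirling_multiple: "0 < p \<Longrightarrow> p ^ (a - j) dvd stirling (a * p) j"
proof (induction a arbitrary: j)
  case (Suc a)
  define Q where "Q = (pochhammer [:a * p, 1:] p :: nat poly)"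
  have "pochhammer [:0, 1:] (Suc a * p) = pochhammer [:0, 1:] (a * p) * Q"
    using pochhammer_product' [of "[:0, 1:] :: nat poly" "a * p" p]
    by (simp add: Q_def of_nat_poly add.commute)
  then have "stirling (Suc a * p) j = coeff (pochhammer [:0, 1:] (a * p) * Q) j"
    using coeff_pochhammer_X [of "Suc a * p" j, where ?'a = nat] by simp
  also have "\<dots> = (\<Sum>i\<le>j. stirling (a * p) i * coeff Q (j - i))"
    by (simp add: coeff_mult coeff_pochhammer_X del: One_nat_def)
  also have "p ^ (Suc a - j) dvd \<dots>"
  proof (rule dvd_sum)
    fix i assume i: "i \<in> {..j}"
    show "p ^ (Suc a - j) dvd stirling (a * p) i * coeff Q (j - i)"
    proof (cases "i = j")
      case True
      have "p dvd coeff Q 0"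
        unfolding Q_def coeff_pochhammer_linear
      proof (rule dvd_sum)
        fix m
        show "p dvd of_nat (stirling p m) * (of_nat (m choose 0) * 1 ^ 0 * (a * p) ^ (m - 0))"
          using Suc.prems by (cases m) (simp_all del: stirling.simps)
      qed
      with Suc.IH [OF Suc.prems, of j] have "p ^ (a - j) * p dvd stirling (a * p) i * coeff Q (j - i)"
        unfolding True by (simp add: mult_dvd_mono)
      moreover have "p ^ (Suc a - j) dvd p ^ (a - j) * p"
        unfolding power_Suc2 [symmetric] by (rule le_imp_power_dvd) simp
      ultimately show ?thesis by (rule dvd_trans [rotated])
    next
      case False
      then have "p ^ (Suc a - j) dvd p ^ (a - i)" using i by (intro le_imp_power_dvd) auto
      with Suc.IH [OF Suc.prems, of i] show ?thesis by (meson dvd_mult2 dvd_trans)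
    qed
  qed
  finally show ?case .
qed simp

section \<open>From divisibility to \<open>p\<close>-adic valuations\<close>

lemma padic_val_of_nat_eqI:
  assumes "p ^ e dvd m" "\<not> p ^ Suc e dvd m" "prime p" "0 < m"
  shows "padic_val p (of_nat m) = int e"
  using assms by (simp add: padic_val_of_nat multiplicity_eqI)

lemma padic_val_ge_iff:
  assumes "prime p" "0 < m"
  shows "int e \<le> padic_val p (of_nat m) \<longleftrightarrow> p ^ e dvd m"
proof -
  have "m \<noteq> 0" "\<not> is_unit p" using assms by (auto dest: not_prime_unit)
  then show ?thesis using assms by (simp add: padic_val_of_nat power_dvd_iff_le_multiplicity)
qed

lemma stirling_pos: "1 \<le> k \<Longrightarrow> k \<le> n \<Longrightarrow> 0 < stirling n k"
proof (induction n arbitrary: k)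
  case (Suc n)
  show ?case
  proof (cases "k = 1")
    case True
    then show ?thesis using stirling_Suc_n_1 [of n] by (simp del: stirling.simps)
  next
    case False
    with Suc obtain j where "k = Suc j" "1 \<le> j" "j \<le> n" by (cases k) auto
    with Suc.IH [of j] show ?thesis by simp
  qed
qed simp

theorem theorem1p1:
  fixes p a k :: nat
  assumes "prime p" "p \<ge> 5"
    and "1 \<le> a" "a \<le> p - 1"
    and "2 \<le> k" "k \<le> a * p - 2"
  shows
    "([k = parity_eps k] (mod (p - 1)) \<longrightarrow>
        padic_val p (of_nat (stirling (a * p) (a * p - k))) =
          (padic_val p (of_nat k) + 1) * int (parity_eps k)) \<and>
     (k \<le> a * (p - 1) - 1 \<and> \<not> [k = parity_eps k] (mod (p - 1)) \<longrightarrow>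
        padic_val p (of_nat (stirling (a * p) (a * p - k))) \<ge>
          (padic_val p (of_nat k) + 1) * int (parity_eps k) + 1 \<and>
        (padic_val p (of_nat (stirling (a * p) (a * p - k))) =
           (padic_val p (of_nat k) + 1) * int (parity_eps k) + 1 \<longleftrightarrow>
         padic_val p (bernoulli (2 * (residue_pred p k div 2))) = 0) \<and>
        (regular_prime p \<longrightarrow>
           padic_val p (of_nat (stirling (a * p) (a * p - k))) =
             (padic_val p (of_nat k) + 1) * int (parity_eps k) + 1)) \<and>
     (a \<ge> 4 \<and> a * (p - 1) + 2 \<le> k \<longrightarrow>
        padic_val p (of_nat (stirling (a * p) (a * p - k))) \<ge>
          int a + int k - int a * int p)"
proof -
  note p = assms(1,2)
  have p3: "3 \<le> p" using p by simp
  have a: "1 \<le> a" "a < p" using assms by auto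
  \<comment> \<open>Since \<open>a * p \<ge> 5\<close>, the natural subtraction in
    \<open>a * p - 2\<close> does not truncate.\<close>
  have k2: "k + 2 \<le> a * p"
  proof -
    have "1 * 5 \<le> a * p" using a p by (intro mult_mono) auto
    with assms(6) show ?thesis by linarith
  qed
  define S where "S = (\<lambda>i. stirling (a * p) (a * p - i))"
  have S_pos: "0 < S i" if "i \<le> k" for i
    using that k2 unfolding S_def by (intro stirling_pos) auto
  define \<epsilon> where "\<epsilon> = parity_eps k"
  define e where "e = (multiplicity p k + 1) * \<epsilon>"
  have e: "(padic_val p (of_nat k) + 1) * int (parity_eps k) = int e"
    using p assms(5) by (simp add: e_def \<epsilon>_def padic_val_of_nat algebra_simps)
  have \<epsilon>: "\<epsilon> \<le> 1" "even (k - \<epsilon>)" "2 \<le> k - \<epsilon>" "\<epsilon> \<le> k"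
    using assms(5) by (auto simp: \<epsilon>_def parity_eps_def) presburger
  \<comment> \<open>Reduction to the even number \<open>k - \<epsilon>\<close>; for even
    \<open>k\<close> it is trivial, as \<open>e\<close> and \<open>\<epsilon>\<close> are 0.\<close>
  have shift: "p ^ (e + i) dvd S k \<longleftrightarrow> p ^ i dvd S (k - \<epsilon>)" if "i \<le> 2" for i
  proof (cases "even k")
    case False
    then have "3 \<le> k" using assms(5) by presburger
    with False power_dvd_stirling_odd_iff [OF p a False _ _ that] k2 show ?thesis
      by (simp add: S_def e_def \<epsilon>_def parity_eps_def)
  qed (simp add: e_def \<epsilon>_def parity_eps_def)
  have cong_iff: "[k = parity_eps k] (mod (p - 1)) \<longleftrightarrow> p - 1 dvd k - \<epsilon>"
    using \<epsilon>(4) unfolding \<epsilon>_def [symmetric] by (rule cong_altdef_nat)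
  have part1: "padic_val p (of_nat (S k)) = int e" if "p - 1 dvd k - \<epsilon>"
  proof -
    have "\<not> p dvd S (k - \<epsilon>)"
      unfolding S_def using that k2 \<epsilon> by (intro stirling_even_unit p p3 a) auto
    with shift [of 0] shift [of 1] S_pos [of k] p show ?thesis
      by (intro padic_val_of_nat_eqI) auto
  qed
  define m where "m = (k - \<epsilon>) mod (p - 1)"
  have part2: "p ^ (e + 1) dvd S k" "p ^ (e + 2) dvd S k \<longleftrightarrow> padic_val p (bernoulli m) \<noteq> 0"
    and m_eq: "2 * (residue_pred p k div 2) = m" and m_range: "even m" "2 \<le> m" "m \<le> p - 3"
    if k: "k \<le> a * (p - 1) - 1" "\<not> p - 1 dvd k - \<epsilon>"
  proof -
    have "even (p - 1)" using p prime_odd_nat [of p] by simp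
    with \<epsilon>(2) show "even m" unfolding m_def by (intro dvd_mod)
    obtain r s where rs: "m = 2 * r" "p - 1 = 2 * s"
      using \<open>even m\<close> \<open>even (p - 1)\<close> by (elim dvdE)
    have "m \<noteq> 0" "m < p - 1" using k(2) p by (simp_all add: m_def dvd_eq_mod_eq_0)
    with rs have "1 \<le> r" "r + 1 \<le> s" by simp_all
    with rs show m2: "2 \<le> m" and m3: "m \<le> p - 3" by simp_all
    \<comment> \<open>Since \<open>m \<le> p - 3\<close>, adding \<open>\<epsilon>\<close> does not
      wrap around; as \<open>m\<close> is even, halving and doubling the residue recovers
      \<open>m\<close>.\<close>
    have "k mod (p - 1) = m + \<epsilon>"
    proof -
      have "k mod (p - 1) = (m + \<epsilon>) mod (p - 1)"
        unfolding m_def mod_add_left_eq using \<epsilon>(4) by (simp only: le_add_diff_inverse2)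
      also have "\<dots> = m + \<epsilon>" using m3 \<epsilon>(1) p by (intro mod_less) linarith
      finally show ?thesis .
    qed
    then show "2 * (residue_pred p k div 2) = m"
      using \<epsilon>(1) rs(1) unfolding residue_pred_def by simp
    have lt: "k - \<epsilon> < a * (p - 1)" using k(1) assms(5) by linarith
    have "p ^ 1 dvd S (k - \<epsilon>)"
      unfolding S_def using stirling_even_nonunit(1) [OF p(1) p3 a \<epsilon>(2) lt k(2)] by simp
    with shift [of 1] show "p ^ (e + 1) dvd S k" by simp
    have "p ^ (e + 2) dvd S k \<longleftrightarrow> p ^ 2 dvd S (k - \<epsilon>)" by (rule shift) simp
    also have "\<dots> \<longleftrightarrow> p ^ 2 dvd stirling p (p - m)"
      unfolding S_def m_def by (rule stirling_even_nonunit(2) [OF p(1) p3 a \<epsilon>(2) lt k(2)])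
    also have "\<dots> \<longleftrightarrow> padic_val p (bernoulli m) \<noteq> 0"
      using m2 m3 p \<open>even m\<close> by (intro prime_square_dvd_stirling_iff) auto
    finally show "p ^ (e + 2) dvd S k \<longleftrightarrow> padic_val p (bernoulli m) \<noteq> 0" .
  qed
  have val_ge: "int i \<le> padic_val p (of_nat (S k)) \<longleftrightarrow> p ^ i dvd S k" for i
    using padic_val_ge_iff [OF p(1) S_pos [of k]] by simp
  have ii: "int e + 1 \<le> padic_val p (of_nat (S k)) \<and>
      (padic_val p (of_nat (S k)) = int e + 1 \<longleftrightarrow>
        padic_val p (bernoulli (2 * (residue_pred p k div 2))) = 0) \<and>
      (regular_prime p \<longrightarrow> padic_val p (of_nat (S k)) = int e + 1)"
    if k: "k \<le> a * (p - 1) - 1" "\<not> p - 1 dvd k - \<epsilon>"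
  proof -
    have ge: "int e + 1 \<le> padic_val p (of_nat (S k))"
      using val_ge [of "e + 1"] part2(1) [OF k] by simp
    have "int e + 2 \<le> padic_val p (of_nat (S k)) \<longleftrightarrow> padic_val p (bernoulli m) \<noteq> 0"
      using val_ge [of "e + 2"] part2(2) [OF k] by (simp add: add.commute)
    with ge have iff: "padic_val p (of_nat (S k)) = int e + 1 \<longleftrightarrow> padic_val p (bernoulli m) = 0"
      by linarith
    moreover have "padic_val p (bernoulli m) = 0" if "regular_prime p"
      using that m_range [OF k] by (simp add: regular_prime_def)
    ultimately show ?thesis using ge unfolding m_eq [OF k] by blast
  qed
  have iii: "int a + int k - int a * int p \<le> padic_val p (of_nat (S k))"
  proof -
    have "p ^ (a - (a * p - k)) dvd S k" unfolding S_def using p by (intro power_dvd_stirling_multiple) simp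
    then have "int (a - (a * p - k)) \<le> padic_val p (of_nat (S k))" by (simp only: val_ge)
    \<comment> \<open>Truncation does no harm: it replaces a negative exponent by 0.\<close>
    moreover have "a + k \<le> (a - (M - k)) + M" if "k \<le> M" for M
      using that by arith
    then have "int (a + k) \<le> int ((a - (a * p - k)) + a * p)" using k2 by (simp only: of_nat_le_iff)
    moreover have "int a + int k - int M \<le> v" if "int x \<le> v" "int (a + k) \<le> int (x + M)" for x M v
      using that by simp
    ultimately have "int a + int k - int (a * p) \<le> padic_val p (of_nat (S k))" by blast
    then show ?thesis by (simp only: of_nat_mult)
  qed
  have fold: "stirling (a * p) (a * p - k) = S k" by (simp add: S_def)
  show ?thesis
    unfolding e cong_iff fold using part1 ii iii by blast
qed

end
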